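(* Let $V$ be an optimal prefix-free machine, and for real $T>0$ let $\Theta_V(T)=\sum_{s\in\{0,1\}^*,\,H_V(s)<|s|}2^{-|s|/T}$. For every $T\in(0,1)$, if $\Theta_V(T)$ is left-computable and $T$ is right-computable, then $T$ is $T$-compressible.
   Context: $\{0,1\}^*$ is the set of finite binary strings; $|s|$ is the length of $s$. A prefix-free machine is a partial recursive function $C:\{0,1\}^*\to\{0,1\}^*$ whose domain is prefix-free. $H_C(s)=\min\{|p| : C(p)=s\}$ (possibly $\infty$). A prefix-free machine $U$ is optimal if for every prefix-free machine $C$ there is $d\in\mathbb{N}$ such that for every $p\in\mathrm{Dom}\,C$ there is $q\in\mathrm{Dom}\,U$ with $U(q)=C(p)$ and $|q|\le|p|+d$. A particular optimal prefix-free machine $U$ is fixed and $H(s):=H_U(s)$. For a real $\alpha$ and $n\ge1$, $\alpha\restriction n$ denotes the first $n$ bits of the base-two expansion of $\alpha-\lfloor\alpha\rfloor$ (the expansion with infinitely many zeros). A real $\alpha$ is right-computable if there is a total recursive $f:\mathbb{N}^+\to\mathbb{Q}$ with $\alpha\le f(n)$ for all $n$ and $\lim_n f(n)=\alpha$; $\alpha$ is left-computable if $-\alpha$ is right-computable. For $T\in(0,1]$, $\alpha$ is $T$-compressible if $\limsup_{n\to\infty}H(\alpha\restriction n)/n\le T$. *)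

theory Defs
  imports "HOL-Analysis.Analysis" "HOL-Library.Extended_Real" "HOL-Library.Nat_Bijection"
begin

datatype recf = Zf | Sf | Proj nat | Comp recf "recf list" | Prim recf recf | Mn recf

inductive eval :: "recf \<Rightarrow> nat list \<Rightarrow> nat \<Rightarrow> bool" where
  eval_Z: "eval Zf xs 0"
| eval_S: "eval Sf (x # xs) (Suc x)"
| eval_Proj: "i < length xs \<Longrightarrow> eval (Proj i) xs (xs ! i)"
| eval_Comp: "list_all2 (\<lambda>g y. eval g xs y) gs ys \<Longrightarrow> eval f ys z \<Longrightarrow> eval (Comp f gs) xs z"
| eval_Prim0: "eval f xs y \<Longrightarrow> eval (Prim f g) (0 # xs) y"
| eval_PrimS: "eval (Prim f g) (n # xs) y \<Longrightarrow> eval g (n # y # xs) z \<Longrightarrow> eval (Prim f g) (Suc n # xs) z"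
| eval_Mn: "eval f (n # xs) 0 \<Longrightarrow> (\<forall>m<n. \<exists>y. y > 0 \<and> eval f (m # xs) y) \<Longrightarrow> eval (Mn f) xs n"

definition partial_recursive :: "(nat \<Rightarrow> nat option) \<Rightarrow> bool" where
  "partial_recursive g \<longleftrightarrow> (\<exists>r. \<forall>x y. eval r [x] y \<longleftrightarrow> g x = Some y)"

text \<open>Bijective base-2 coding: 0 is the empty string.\<close>
fun dec_bl :: "nat \<Rightarrow> bool list" where
  "dec_bl 0 = []"
| "dec_bl (Suc n) = odd n # dec_bl (n div 2)"

primrec enc_bl :: "bool list \<Rightarrow> nat" where
  "enc_bl [] = 0"
| "enc_bl (b # bs) = Suc (2 * enc_bl bs + (if b then 1 else 0))"

definition partial_recursive_bl :: "(bool list \<Rightarrow> bool list option) \<Rightarrow> bool" where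
  "partial_recursive_bl C \<longleftrightarrow> partial_recursive (\<lambda>n. map_option enc_bl (C (dec_bl n)))"

definition prefix_free_set :: "bool list set \<Rightarrow> bool" where
  "prefix_free_set A \<longleftrightarrow> (\<forall>p\<in>A. \<forall>q\<in>A. \<forall>r. q = p @ r \<longrightarrow> r = [])"

definition prefix_free_machine :: "(bool list \<Rightarrow> bool list option) \<Rightarrow> bool" where
  "prefix_free_machine C \<longleftrightarrow> partial_recursive_bl C \<and> prefix_free_set (dom C)"

text \<open>Program-size complexity relative to a machine; infinity if s is not an output.\<close>
definition HC :: "(bool list \<Rightarrow> bool list option) \<Rightarrow> bool list \<Rightarrow> enat" where
  "HC C s = (INF p\<in>{p. C p = Some s}. enat (length p))"

definition optimal_machine :: "(bool list \<Rightarrow> bool list option) \<Rightarrow> bool" where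
  "optimal_machine U \<longleftrightarrow> prefix_free_machine U \<and>
     (\<forall>C. prefix_free_machine C \<longrightarrow>
        (\<exists>d::nat. \<forall>p\<in>dom C. \<exists>q\<in>dom U. U q = C p \<and> length q \<le> length p + d))"

definition rat_enc :: "rat \<Rightarrow> nat" where
  "rat_enc q = prod_encode (int_encode (fst (quotient_of q)), int_encode (snd (quotient_of q)))"

definition total_recursive_rat_seq :: "(nat \<Rightarrow> rat) \<Rightarrow> bool" where
  "total_recursive_rat_seq f \<longleftrightarrow> partial_recursive (\<lambda>n. Some (rat_enc (f n)))"

text \<open>Indexing from 0 instead of 1 (harmless shift).\<close>
definition right_computable :: "real \<Rightarrow> bool" where
  "right_computable \<alpha> \<longleftrightarrow> (\<exists>f. total_recursive_rat_seq f \<and> (\<forall>n. \<alpha> \<le> of_rat (f n))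
      \<and> (\<lambda>n. of_rat (f n)) \<longlonglongrightarrow> \<alpha>)"

definition left_computable :: "real \<Rightarrow> bool" where
  "left_computable \<alpha> \<longleftrightarrow> right_computable (- \<alpha>)"

text \<open>First n bits of the base-two expansion (infinitely many zeros) of frac alpha.\<close>
definition bits :: "real \<Rightarrow> nat \<Rightarrow> bool list" where
  "bits \<alpha> n = map (\<lambda>k. odd \<lfloor>2 ^ k * frac \<alpha>\<rfloor>) [1..<Suc n]"

definition T_compressible :: "(bool list \<Rightarrow> bool list option) \<Rightarrow> real \<Rightarrow> real \<Rightarrow> bool" where
  "T_compressible U T \<alpha> \<longleftrightarrow>
     limsup (\<lambda>n. ereal_of_enat (HC U (bits \<alpha> n)) / ereal (real n)) \<le> ereal T"

definition Theta_set :: "(bool list \<Rightarrow> bool list option) \<Rightarrow> bool list set" where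
  "Theta_set V = {s. HC V s < enat (length s)}"

definition Theta :: "(bool list \<Rightarrow> bool list option) \<Rightarrow> real \<Rightarrow> real" where
  "Theta V T = (\<Sum>\<^sub>\<infinity>s\<in>Theta_set V. 2 powr (- real (length s) / T))"

end

theory Submission
  imports Defs "HOL-Real_Asymp.Real_Asymp"
begin

text \<open>
  Let \<open>\<beta>\<close> be the sum of \<open>2\<^bsup>-|s|\<^esup>\<close> over the compressible strings, which is at most \<open>1\<close> by Kraft's
  inequality. The first \<open>j = \<lceil>Tn\<rceil>\<close> bits of \<open>\<beta>\<close> determine a finite stage \<open>F\<close> of the enumeration of the
  compressible strings that misses at most \<open>2\<^bsup>-j\<^esup>\<close> of \<open>\<beta>\<close>. Since \<open>\<Sum> x\<^bsup>1/T\<^esup> \<le> (\<Sum> x)\<^bsup>1/T\<^esup>\<close>, it misses at most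
  \<open>2\<^bsup>-n\<^esup>\<close> of \<open>\<Theta>(T)\<close>. Now search for an upper approximation \<open>t\<close> of \<open>T\<close> for which the sum \<open>\<Theta>\<^sub>F(t)\<close> over \<open>F\<close> is at
  most a lower approximation of \<open>\<Theta>(T)\<close>. Such \<open>t\<close> exists because \<open>\<Theta>\<^sub>F(T) < \<Theta>(T)\<close>, and it satisfies
  \<open>\<Theta>\<^sub>F(t) \<le> \<Theta>(T) \<le> \<Theta>\<^sub>F(T) + 2\<^bsup>-n\<^esup>\<close>. As \<open>\<Theta>\<^sub>F\<close> increases at a rate bounded below, \<open>t - T = O(2\<^bsup>-n\<^esup>)\<close>, so
  boundedly many further choices determine the first \<open>n\<close> bits of \<open>T\<close>. The program has length
  \<open>Tn + O(log n)\<close>.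
\<close>

section \<open>Recursive functions\<close>

inductive_simps eval_Zf_iff: "eval Zf xs y"
inductive_simps eval_Sf_iff: "eval Sf xs y"
inductive_simps eval_Proj_iff: "eval (Proj i) xs y"
inductive_simps eval_Comp_iff: "eval (Comp f gs) xs y"
inductive_simps eval_Prim_0_iff: "eval (Prim f g) (0 # xs) y"
inductive_simps eval_Prim_Suc_iff: "eval (Prim f g) (Suc n # xs) y"
inductive_simps eval_Prim_Nil_iff: "eval (Prim f g) [] y"
inductive_simps eval_Mn_iff: "eval (Mn f) xs y"

text \<open>The equivalence, rather than mere existence of a value, records totality and uniqueness
  together; lists of a length other than \<open>k\<close> are left unconstrained.\<close>

definition rec_fun :: "nat \<Rightarrow> (nat list \<Rightarrow> nat) \<Rightarrow> bool" where
  "rec_fun k f \<longleftrightarrow> (\<exists>r. \<forall>xs. length xs = k \<longrightarrow> (\<forall>y. eval r xs y \<longleftrightarrow> y = f xs))"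

lemma rec_fun_cong:
  assumes "rec_fun k f" "\<And>xs. length xs = k \<Longrightarrow> f xs = g xs"
  shows "rec_fun k g"
  using assms unfolding rec_fun_def by metis

lemma rec_fun_zero: "rec_fun k (\<lambda>xs. 0)"
  unfolding rec_fun_def by (rule exI[of _ Zf]) (simp add: eval_Zf_iff)

lemma rec_fun_nth: "i < k \<Longrightarrow> rec_fun k (\<lambda>xs. xs ! i)"
  unfolding rec_fun_def by (rule exI[of _ "Proj i"]) (auto simp: eval_Proj_iff)

lemma rec_fun_Comp:
  assumes f: "rec_fun (length gs) f" and gs: "\<forall>g\<in>set gs. rec_fun k g"
  shows "rec_fun k (\<lambda>xs. f (map (\<lambda>g. g xs) gs))"
proof -
  obtain rf where rf: "\<And>xs y. length xs = length gs \<Longrightarrow> eval rf xs y \<longleftrightarrow> y = f xs"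
    using f unfolding rec_fun_def by metis
  obtain R where R: "\<And>g xs y. g \<in> set gs \<Longrightarrow> length xs = k \<Longrightarrow> eval (R g) xs y \<longleftrightarrow> y = g xs"
    using gs unfolding rec_fun_def by metis
  have *: "list_all2 (\<lambda>r y. eval r xs y) (map R hs) ys \<longleftrightarrow> ys = map (\<lambda>g. g xs) hs"
    if "length xs = k" "set hs \<subseteq> set gs" for xs ys hs
    using that(2) by (induction hs arbitrary: ys) (auto simp: list_all2_Cons1 R that(1))
  show ?thesis unfolding rec_fun_def
    by (rule exI[of _ "Comp rf (map R gs)"]) (auto simp: eval_Comp_iff * rf)
qed

lemma rec_fun_compose1:
  assumes "rec_fun (Suc 0) (\<lambda>xs. F (xs ! 0))" "rec_fun k f"
  shows "rec_fun k (\<lambda>xs. F (f xs))"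
  using rec_fun_Comp[of "[f]" "\<lambda>xs. F (xs ! 0)" k] assms by simp

lemma rec_fun_compose2:
  assumes "rec_fun 2 (\<lambda>xs. F (xs ! 0) (xs ! 1))" "rec_fun k f" "rec_fun k g"
  shows "rec_fun k (\<lambda>xs. F (f xs) (g xs))"
  using rec_fun_Comp[of "[f, g]" "\<lambda>xs. F (xs ! 0) (xs ! 1)" k] assms
  by (simp add: numeral_2_eq_2)

lemma rec_fun_Suc:
  assumes "rec_fun k f" shows "rec_fun k (\<lambda>xs. Suc (f xs))"
proof (rule rec_fun_compose1[OF _ assms])
  show "rec_fun (Suc 0) (\<lambda>xs. Suc (xs ! 0))"
    unfolding rec_fun_def by (rule exI[of _ Sf]) (auto simp: eval_Sf_iff length_Suc_conv)
qed

lemma rec_fun_const: "rec_fun k (\<lambda>xs. c)"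
  by (induction c) (auto intro: rec_fun_zero rec_fun_Suc)

lemma rec_fun_Prim:
  assumes "rec_fun k a" "rec_fun (Suc (Suc k)) s"
  shows "rec_fun (Suc k) (\<lambda>xs. rec_nat (a (tl xs)) (\<lambda>n y. s (n # y # tl xs)) (hd xs))"
proof -
  obtain ra where ra: "\<And>xs y. length xs = k \<Longrightarrow> eval ra xs y \<longleftrightarrow> y = a xs"
    using assms(1) unfolding rec_fun_def by metis
  obtain rs where rs: "\<And>xs y. length xs = Suc (Suc k) \<Longrightarrow> eval rs xs y \<longleftrightarrow> y = s xs"
    using assms(2) unfolding rec_fun_def by metis
  have "eval (Prim ra rs) (n # xs) y \<longleftrightarrow> y = rec_nat (a xs) (\<lambda>n y. s (n # y # xs)) n"
    if "length xs = k" for n xs y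
    by (induction n arbitrary: y)
       (auto simp: eval_Prim_0_iff eval_Prim_Suc_iff ra rs that)
  then show ?thesis unfolding rec_fun_def
    by (intro exI[of _ "Prim ra rs"]) (auto simp: length_Suc_conv)
qed

lemma rec_fun_add: "rec_fun 2 (\<lambda>xs. xs ! 0 + xs ! 1)"
proof -
  have *: "rec_nat b (\<lambda>n. Suc) a = a + b" for a b :: nat by (induction a) auto
  show ?thesis
    unfolding numeral_2_eq_2
    by (rule rec_fun_cong[OF rec_fun_Prim[OF rec_fun_nth[of 0] rec_fun_Suc[OF rec_fun_nth[of 1]]]])
       (auto simp: * length_Suc_conv)
qed

lemma rec_fun_pred: "rec_fun (Suc 0) (\<lambda>xs. xs ! 0 - 1)"
proof -
  have *: "rec_nat 0 (\<lambda>n y. n) a = a - 1" for a :: nat by (cases a) auto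
  show ?thesis
    by (rule rec_fun_cong[OF rec_fun_Prim[OF rec_fun_zero rec_fun_nth[of 0]]])
       (auto simp: * length_Suc_conv)
qed

lemma rec_fun_diff: "rec_fun 2 (\<lambda>xs. xs ! 0 - xs ! 1)"
proof -
  have *: "rec_nat b (\<lambda>n y. y - Suc 0) a = b - a" for a b :: nat by (induction a) auto
  \<comment> \<open>Primitive recursion runs on the first argument, so subtraction first appears
    with its arguments exchanged.\<close>
  have "rec_fun 2 (\<lambda>xs. xs ! 1 - xs ! 0)"
    unfolding numeral_2_eq_2
    by (rule rec_fun_cong[OF rec_fun_Prim[OF rec_fun_nth[of 0]
          rec_fun_compose1[OF rec_fun_pred rec_fun_nth[of 1]]]])
       (auto simp: * length_Suc_conv)
  from rec_fun_compose2[OF this rec_fun_nth[of 1] rec_fun_nth[of 0], of 2]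
  show ?thesis by simp
qed

lemma rec_fun_triangle: "rec_fun (Suc 0) (\<lambda>xs. triangle (xs ! 0))"
proof -
  have *: "rec_nat 0 (\<lambda>n y. y + Suc n) a = triangle a" for a :: nat by (induction a) auto
  show ?thesis
    by (rule rec_fun_cong[OF rec_fun_Prim[OF rec_fun_zero
          rec_fun_compose2[OF rec_fun_add rec_fun_nth[of 1] rec_fun_Suc[OF rec_fun_nth[of 0]]]]])
       (auto simp: * length_Suc_conv simp del: add_Suc_right)
qed

section \<open>The pairing function and its inverses\<close>

definition pfst :: "nat \<Rightarrow> nat" where "pfst z = fst (prod_decode z)"
definition psnd :: "nat \<Rightarrow> nat" where "psnd z = snd (prod_decode z)"
definition pair :: "nat \<Rightarrow> nat \<Rightarrow> nat" where "pair a b = prod_encode (a, b)"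

lemma pfst_pair [simp]: "pfst (pair a b) = a" and psnd_pair [simp]: "psnd (pair a b) = b"
  by (simp_all add: pfst_def psnd_def pair_def)

lemma pair_pfst_psnd [simp]: "pair (pfst z) (psnd z) = z"
  by (simp add: pfst_def psnd_def pair_def)

lemma triangle_mono: "m \<le> n \<Longrightarrow> triangle m \<le> triangle n"
  unfolding triangle_def by (intro div_le_mono mult_le_mono) auto

text \<open>The sum of the two components is the largest \<open>w\<close> with \<open>triangle w \<le> z\<close>; this is the only
  search needed to undo the pairing.\<close>

lemma triangle_psum: "triangle (pfst z + psnd z) + pfst z = z"
  using pair_pfst_psnd[of z] unfolding pair_def prod_encode_def by simp

text \<open>The sum w of the components stays the same until z + 1 reaches the next triangular
  number and then grows by one. Truncated subtraction expresses this case distinction, so the sum is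
  obtained by primitive recursion.\<close>

lemma psum_Suc:
  "pfst (Suc z) + psnd (Suc z) =
    (pfst z + psnd z) + (1 - (triangle (Suc (pfst z + psnd z)) - Suc z))"
proof -
  define w where "w = pfst z + psnd z"
  define w' where "w' = pfst (Suc z) + psnd (Suc z)"
  have 1: "triangle w \<le> z" "z < triangle (Suc w)"
    using triangle_psum[of z] by (auto simp: w_def)
  have 2: "triangle w' \<le> Suc z" "Suc z < triangle (Suc w')"
    using triangle_psum[of "Suc z"] by (auto simp: w'_def)
  have "w' < Suc (Suc w)"
    using triangle_mono[of "Suc (Suc w)" w'] 1 2 by (cases "w' < Suc (Suc w)") auto
  moreover have "w < Suc w'"
    using triangle_mono[of "Suc w'" w] 1 2 by (cases "w < Suc w'") auto
  ultimately have "w' = w \<or> w' = Suc w" by auto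
  then have "w' = w + (1 - (triangle (Suc w) - Suc z))"
    using 1 2 by auto
  then show ?thesis by (simp only: w_def w'_def)
qed

lemma rec_fun_psum: "rec_fun (Suc 0) (\<lambda>xs. pfst (xs ! 0) + psnd (xs ! 0))"
proof -
  have 0: "pfst 0 = 0" "psnd 0 = 0"
    using prod_encode_inverse[of "(0, 0)"] by (auto simp: pfst_def psnd_def prod_encode_def)
  have *: "rec_nat 0 (\<lambda>n y. y + (1 - (triangle (Suc y) - Suc n))) a = pfst a + psnd a" for a
  proof (induction a)
    case (Suc a)
    then show ?case by (simp only: psum_Suc old.nat.simps)
  qed (simp add: 0)
  show ?thesis
    by (rule rec_fun_cong[OF rec_fun_Prim[OF rec_fun_zero
          rec_fun_compose2[OF rec_fun_add rec_fun_nth[of 1]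
            rec_fun_compose2[OF rec_fun_diff rec_fun_const[of _ 1]
              rec_fun_compose2[OF rec_fun_diff
                rec_fun_compose1[OF rec_fun_triangle rec_fun_Suc[OF rec_fun_nth[of 1]]]
                rec_fun_Suc[OF rec_fun_nth[of 0]]]]]]])
       (auto simp: *[simplified] length_Suc_conv)
qed

section \<open>Computable functions of one encoded argument\<close>

text \<open>Functions of several arguments are treated as functions of one number, read through \<open>pfst\<close>
  and \<open>psnd\<close>; a variable bound in a subterm is appended to the argument by \<open>pair\<close>.\<close>

definition computable :: "(nat \<Rightarrow> nat) \<Rightarrow> bool" where
  "computable f \<longleftrightarrow> rec_fun (Suc 0) (\<lambda>xs. f (xs ! 0))"

definition decidable :: "(nat \<Rightarrow> bool) \<Rightarrow> bool" where
  "decidable P \<longleftrightarrow> computable (\<lambda>x. of_bool (P x))"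

lemma computable_iff_partial_recursive: "computable f \<longleftrightarrow> partial_recursive (\<lambda>x. Some (f x))"
  unfolding computable_def partial_recursive_def rec_fun_def
proof (rule iff_exI)
  fix r
  show "(\<forall>xs. length xs = Suc 0 \<longrightarrow> (\<forall>y. eval r xs y = (y = f (xs ! 0)))) \<longleftrightarrow>
      (\<forall>x y. eval r [x] y = (Some (f x) = Some y))"
    by (auto simp: length_Suc_conv)
qed

lemma computable_id: "computable (\<lambda>x. x)"
  unfolding computable_def by (rule rec_fun_nth) simp

lemma computable_const: "computable (\<lambda>x. c)"
  unfolding computable_def by (rule rec_fun_const)

lemma computable_Suc: "computable f \<Longrightarrow> computable (\<lambda>x. Suc (f x))"
  unfolding computable_def by (rule rec_fun_Suc)

lemma computable_compose: "computable g \<Longrightarrow> computable f \<Longrightarrow> computable (\<lambda>x. g (f x))"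
  unfolding computable_def by (rule rec_fun_compose1)

lemma rec_fun_computable: "computable g \<Longrightarrow> rec_fun k f \<Longrightarrow> rec_fun k (\<lambda>xs. g (f xs))"
  unfolding computable_def by (rule rec_fun_compose1)

lemma computable_add: "computable f \<Longrightarrow> computable g \<Longrightarrow> computable (\<lambda>x. f x + g x)"
  unfolding computable_def by (rule rec_fun_compose2[OF rec_fun_add])

lemma computable_diff: "computable f \<Longrightarrow> computable g \<Longrightarrow> computable (\<lambda>x. f x - g x)"
  unfolding computable_def by (rule rec_fun_compose2[OF rec_fun_diff])

lemma rec_fun_pair: "rec_fun k f \<Longrightarrow> rec_fun k g \<Longrightarrow> rec_fun k (\<lambda>xs. pair (f xs) (g xs))"
  unfolding pair_def prod_encode_def prod.case
  by (intro rec_fun_compose2[OF rec_fun_add] rec_fun_compose1[OF rec_fun_triangle])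

lemma computable_pair: "computable f \<Longrightarrow> computable g \<Longrightarrow> computable (\<lambda>x. pair (f x) (g x))"
  unfolding computable_def by (rule rec_fun_pair)

lemma computable_pfst: "computable f \<Longrightarrow> computable (\<lambda>x. pfst (f x))"
proof (rule computable_compose[of pfst])
  have z: "z - triangle (pfst z + psnd z) = pfst z" for z
    using triangle_psum[of z] by linarith
  show "computable pfst"
    unfolding computable_def
    by (rule rec_fun_cong[OF rec_fun_compose2[OF rec_fun_diff rec_fun_nth[of 0]
          rec_fun_compose1[OF rec_fun_triangle rec_fun_psum]]])
       (auto simp: z)
qed

lemma computable_psnd: "computable f \<Longrightarrow> computable (\<lambda>x. psnd (f x))"
proof (rule computable_compose[of psnd])
  show "computable psnd"
    unfolding computable_def
    by (rule rec_fun_cong[OF rec_fun_compose2[OF rec_fun_diff rec_fun_psum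
           rec_fun_computable[OF computable_pfst[OF computable_id] rec_fun_nth[of 0]]]])
       auto
qed

lemma computable_compose2:
  assumes "computable (\<lambda>z. F (pfst z) (psnd z))" "computable f" "computable g"
  shows "computable (\<lambda>x. F (f x) (g x))"
  using computable_compose[OF assms(1) computable_pair[OF assms(2,3)]] by simp

lemma computable_rec_nat:
  assumes "computable a" "computable b"
    and "computable (\<lambda>z. s (pfst z) (pfst (psnd z)) (psnd (psnd z)))"
  shows "computable (\<lambda>x. rec_nat (a x) (s x) (b x))"
proof -
  have "rec_fun 3 (\<lambda>xs. s (xs ! 2) (xs ! 0) (xs ! 1))"
    using rec_fun_computable[OF assms(3) rec_fun_pair[OF rec_fun_nth[of 2]
      rec_fun_pair[OF rec_fun_nth[of 0] rec_fun_nth[of 1]]], of 3] by simp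
  then have step: "rec_fun (Suc (Suc (Suc 0))) (\<lambda>xs. s (xs ! 2) (xs ! 0) (xs ! 1))"
    by (simp only: numeral_3_eq_3)
  have "rec_fun 2 (\<lambda>xs. rec_nat (a (xs ! 1)) (s (xs ! 1)) (xs ! 0))"
    unfolding numeral_2_eq_2
    by (rule rec_fun_cong[OF rec_fun_Prim[OF assms(1)[unfolded computable_def] step]])
       (auto simp: length_Suc_conv)
  from rec_fun_compose2[OF this assms(2)[unfolded computable_def] rec_fun_nth[of 0]]
  show ?thesis by (simp add: computable_def)
qed

lemma computable_mult:
  assumes "computable f" "computable g" shows "computable (\<lambda>x. f x * g x)"
proof -
  have *: "rec_nat 0 (\<lambda>n y. y + b) a = a * b" for a b :: nat by (induction a) auto
  have "computable (\<lambda>x. rec_nat 0 (\<lambda>n y. y + g x) (f x))"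
    by (intro computable_rec_nat computable_const assms computable_add computable_psnd computable_id
        computable_compose[OF assms(2)] computable_pfst)
  then show ?thesis by (simp add: *)
qed

lemma computable_power:
  assumes "computable f" "computable g" shows "computable (\<lambda>x. f x ^ g x)"
proof -
  have *: "rec_nat (Suc 0) (\<lambda>n y. y * b) a = b ^ a" for a b :: nat by (induction a) auto
  have "computable (\<lambda>x. rec_nat (Suc 0) (\<lambda>n y. y * f x) (g x))"
    by (intro computable_rec_nat computable_const assms computable_mult computable_psnd computable_id
        computable_compose[OF assms(1)] computable_pfst)
  then show ?thesis by (simp add: *)
qed

section \<open>Decidable predicates, bounded quantifiers and division\<close>

lemma decidable_le:
  assumes "computable f" "computable g" shows "decidable (\<lambda>x. f x \<le> g x)"
proof -
  have *: "of_bool (a \<le> b) = 1 - (a - b)" for a b :: nat by auto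
  show ?thesis unfolding decidable_def * by (intro computable_diff computable_const assms)
qed

lemma decidable_not:
  assumes "decidable P" shows "decidable (\<lambda>x. \<not> P x)"
proof -
  have *: "of_bool (\<not> p) = 1 - (of_bool p :: nat)" for p by auto
  show ?thesis
    using assms unfolding decidable_def * by (intro computable_diff computable_const)
qed

lemma decidable_conj: "decidable P \<Longrightarrow> decidable Q \<Longrightarrow> decidable (\<lambda>x. P x \<and> Q x)"
  unfolding decidable_def of_bool_conj by (rule computable_mult)

lemma decidable_less: "computable f \<Longrightarrow> computable g \<Longrightarrow> decidable (\<lambda>x. f x < g x)"
  unfolding not_le[symmetric] by (intro decidable_not decidable_le)

lemma decidable_eq: "computable f \<Longrightarrow> computable g \<Longrightarrow> decidable (\<lambda>x. f x = g x)"
  unfolding order_eq_iff by (intro decidable_conj decidable_le)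

lemma decidable_compose: "decidable P \<Longrightarrow> computable f \<Longrightarrow> decidable (\<lambda>x. P (f x))"
  unfolding decidable_def by (rule computable_compose)

lemma decidable_compose2:
  assumes "decidable (\<lambda>z. P (pfst z) (psnd z))" "computable f" "computable g"
  shows "decidable (\<lambda>x. P (f x) (g x))"
  using decidable_compose[OF assms(1) computable_pair[OF assms(2,3)]] by simp

lemma computable_if:
  assumes "decidable P" "computable f" "computable g"
  shows "computable (\<lambda>x. if P x then f x else g x)"
proof -
  have *: "(if p then a else b) = of_bool p * a + (1 - of_bool p) * b" for p and a b :: nat by auto
  show ?thesis unfolding *
    by (intro computable_add computable_mult computable_diff computable_const assms
        assms(1)[unfolded decidable_def])
qed

lemma computable_sum:
  assumes "computable b" "computable (\<lambda>z. f (pfst z) (psnd z))"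
  shows "computable (\<lambda>x. \<Sum>i<b x. f x i)"
proof -
  have *: "rec_nat 0 (\<lambda>n y. y + g n) a = (\<Sum>i<a. g i)" for a :: nat and g :: "nat \<Rightarrow> nat"
    by (induction a) auto
  have "computable (\<lambda>x. rec_nat 0 (\<lambda>n y. y + f x n) (b x))"
    by (intro computable_rec_nat computable_const assms computable_add computable_psnd computable_id
        computable_compose2[OF assms(2)] computable_pfst)
  then show ?thesis by (simp add: *)
qed

lemma decidable_bex:
  assumes "computable b" "decidable (\<lambda>z. P (pfst z) (psnd z))"
  shows "decidable (\<lambda>x. \<exists>i<b x. P x i)"
proof -
  have *: "(\<exists>i<n. Q i) \<longleftrightarrow> 0 < (\<Sum>i<n. of_bool (Q i) :: nat)" for n :: nat and Q
    by (auto simp: zero_less_iff_neq_zero)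
  show ?thesis unfolding *
    by (intro decidable_less computable_const computable_sum assms assms(2)[unfolded decidable_def])
qed

lemma decidable_ball:
  assumes "computable b" "decidable (\<lambda>z. P (pfst z) (psnd z))"
  shows "decidable (\<lambda>x. \<forall>i<b x. P x i)"
proof -
  have "decidable (\<lambda>x. \<not> (\<exists>i<b x. \<not> P x i))"
    by (intro decidable_not decidable_bex assms)
  then show ?thesis by simp
qed

lemma computable_div:
  assumes "computable f" "computable g" shows "computable (\<lambda>x. f x div g x)"
proof -
  \<comment> \<open>The quotient counts the positive multiples of \<open>b\<close> up to
    \<open>a\<close>. For b = 0 every index would be counted, so this case is separated.\<close>
  have *: "a div b = (if b = 0 then 0 else \<Sum>i<a. of_bool (Suc i * b \<le> a))" for a b :: nat
  proof (cases "b = 0")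
    case False
    have "(\<Sum>i<a. of_bool (Suc i * b \<le> a) :: nat) = card {i. i < a \<and> Suc i * b \<le> a}"
      by (simp add: sum_of_bool_eq Int_def)
    also have "{i. i < a \<and> Suc i * b \<le> a} = {..<a div b}"
    proof -
      have *: "Suc i * b \<le> a \<longleftrightarrow> i < a div b" for i
        using False less_eq_div_iff_mult_less_eq[of b "Suc i" a] by (simp only: Suc_le_eq neq0_conv)
      show ?thesis
        unfolding * using div_le_dividend[of a b] by (auto intro: order.strict_trans2)
    qed
    finally show ?thesis using False by simp
  qed simp
  have dec: "computable (\<lambda>x. of_bool (P x))" if "decidable P" for P
    using that by (simp add: decidable_def)
  show ?thesis unfolding *
    by (intro computable_if decidable_eq computable_const computable_sum dec decidable_le
        computable_mult computable_Suc computable_id computable_pfst computable_psnd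
        computable_compose[OF assms(1)] computable_compose[OF assms(2)] assms)
qed

lemma computable_mod:
  assumes "computable f" "computable g" shows "computable (\<lambda>x. f x mod g x)"
  unfolding modulo_nat_def by (intro computable_diff computable_mult computable_div assms)

lemmas computable_basic = computable_id computable_const computable_Suc computable_add computable_diff
  computable_mult computable_power computable_div computable_mod computable_pair computable_pfst
  computable_psnd computable_if decidable_le decidable_less decidable_eq decidable_not decidable_conj

text \<open>Machines are built by unbounded search for a witness. As \<open>out\<close> sees only
  the witness, the witness must carry everything that the output depends on.\<close>

lemma partial_recursive_search:
  assumes "decidable (\<lambda>z. R (pfst z) (psnd z))" "computable out"
  shows "partial_recursive (\<lambda>x. if \<exists>z. R x z then Some (out (LEAST z. R x z)) else None)"
proof -
  have "computable (\<lambda>z. of_bool (\<not> R (psnd z) (pfst z)))"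
    using decidable_not[OF decidable_compose2[OF assms(1) computable_psnd[OF computable_id]
          computable_pfst[OF computable_id]]]
    by (simp add: decidable_def)
  from rec_fun_computable[OF this rec_fun_pair[OF rec_fun_nth[of 0] rec_fun_nth[of 1]], of 2]
  have "rec_fun 2 (\<lambda>xs. of_bool (\<not> R (xs ! 1) (xs ! 0)))" by simp
  then obtain r where "\<And>xs y. length xs = 2 \<Longrightarrow> eval r xs y \<longleftrightarrow> y = of_bool (\<not> R (xs ! 1) (xs ! 0))"
    unfolding rec_fun_def by auto
  then have r: "eval r [z, x] y \<longleftrightarrow> y = of_bool (\<not> R x z)" for x z y by simp
  obtain ro where "\<And>xs y. length xs = Suc 0 \<Longrightarrow> eval ro xs y \<longleftrightarrow> y = out (xs ! 0)"
    using assms(2) unfolding computable_def rec_fun_def by auto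
  then have ro: "eval ro [z] y \<longleftrightarrow> y = out z" for z y by simp
  have Mn: "eval (Mn r) [x] z \<longleftrightarrow> R x z \<and> (\<forall>m<z. \<not> R x m)" for x z
    by (auto simp: eval_Mn_iff r)
  have least: "R x z \<and> (\<forall>m<z. \<not> R x m) \<longleftrightarrow> (\<exists>z. R x z) \<and> z = (LEAST z. R x z)" for x z
    by (metis LeastI Least_le linorder_le_less_linear not_less_Least order_antisym)
  show ?thesis unfolding partial_recursive_def
    by (rule exI[of _ "Comp ro [Mn r]"])
       (auto simp: eval_Comp_iff list_all2_Cons1 ro Mn least simp del: ex_simps)
qed

section \<open>Clocked evaluation\<close>

text \<open>\<open>S t\<close> returns \<open>Suc y\<close> once \<open>t\<close> steps suffice to find the value \<open>y\<close>, and \<open>0\<close> before that.\<close>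

definition clocks :: "(nat \<Rightarrow> nat \<Rightarrow> nat) \<Rightarrow> (nat list \<Rightarrow> nat \<Rightarrow> bool) \<Rightarrow> bool" where
  "clocks S P \<longleftrightarrow> computable (\<lambda>z. S (pfst z) (psnd z)) \<and>
    (\<forall>t t' v y. S t v = Suc y \<longrightarrow> t \<le> t' \<longrightarrow> S t' v = Suc y) \<and>
    (\<forall>xs y. P xs y \<longleftrightarrow> (\<exists>t. S t (list_encode xs) = Suc y))"

lemma clocksI:
  assumes "computable (\<lambda>z. S (pfst z) (psnd z))"
    and "\<And>t t' v y. S t v = Suc y \<Longrightarrow> t \<le> t' \<Longrightarrow> S t' v = Suc y"
    and "\<And>xs y. P xs y \<longleftrightarrow> (\<exists>t. S t (list_encode xs) = Suc y)"
  shows "clocks S P"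
  using assms unfolding clocks_def by blast

lemma
  assumes "clocks S P"
  shows clocks_computable: "computable (\<lambda>z. S (pfst z) (psnd z))"
    and clocks_mono: "S t v = Suc y \<Longrightarrow> t \<le> t' \<Longrightarrow> S t' v = Suc y"
    and clocks_iff: "P xs y \<longleftrightarrow> (\<exists>t. S t (list_encode xs) = Suc y)"
  using assms unfolding clocks_def by blast+

text \<open>By monotonicity in time, two halting computations both halt within the larger of their
  two time bounds.\<close>

lemma clocks_ex_conj:
  assumes "clocks S P" "clocks S' P'"
  shows "(\<exists>t. S t v = Suc y) \<and> (\<exists>t. S' t w = Suc z) \<longleftrightarrow> (\<exists>t. S t v = Suc y \<and> S' t w = Suc z)"
  using clocks_mono[OF assms(1)] clocks_mono[OF assms(2)] by (meson max.cobounded1 max.cobounded2)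

lemma list_encode_Cons_pair: "list_encode (x # xs) = Suc (pair x (list_encode xs))"
  by (simp add: pair_def)

lemma clocks_Zf: "\<exists>S. clocks S (eval Zf)"
  by (rule exI[of _ "\<lambda>t v. Suc 0"], rule clocksI) (auto intro: computable_const simp: eval_Zf_iff)

lemma clocks_Sf: "\<exists>S. clocks S (eval Sf)"
proof (rule exI[of _ "\<lambda>t v. if v = 0 then 0 else Suc (Suc (pfst (v - 1)))"], rule clocksI)
  fix xs y
  show "eval Sf xs y \<longleftrightarrow> (\<exists>t::nat. (if list_encode xs = 0 then 0
      else Suc (Suc (pfst (list_encode xs - 1)))) = Suc y)"
    by (cases xs) (auto simp: eval_Sf_iff list_encode_Cons_pair simp del: list_encode.simps(2))
qed (auto intro!: computable_basic)

lemma clocks_Proj: "\<exists>S. clocks S (eval (Proj i))"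
proof -
  \<comment> \<open>\<open>d i\<close> drops \<open>i\<close> entries from a list code. The code 0
    of the empty list is a fixed point because \<open>psnd 0 = 0\<close>, so lists that are too
    short end up at 0.\<close>
  define d where "d = rec_nat (\<lambda>v. v) (\<lambda>_ f v. f (psnd (v - 1)))"
  have d: "d 0 v = v" "d (Suc i) v = d i (psnd (v - 1))" for i v by (simp_all add: d_def)
  have comp: "computable (d i)" for i
  proof (induction i)
    case 0
    have "d 0 = (\<lambda>v. v)" by (auto simp: d)
    then show ?case by (simp add: computable_id)
  next
    case (Suc i)
    have "computable (\<lambda>v. d i (psnd (v - 1)))"
      by (intro computable_compose[OF Suc] computable_basic)
    moreover have "d (Suc i) = (\<lambda>v. d i (psnd (v - 1)))" by (auto simp: d)
    ultimately show ?case by simp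
  qed
  have psnd0: "psnd 0 = 0"
    using psnd_pair[of 0 0] by (simp add: pair_def prod_encode_def)
  have d0: "d i 0 = 0" for i by (induction i) (auto simp: d psnd0)
  have drop: "d i (list_encode xs) = list_encode (drop i xs)" for i xs
  proof (induction i arbitrary: xs)
    case (Suc i)
    then show ?case
      by (cases xs) (auto simp: d d0 psnd0 list_encode_Cons_pair simp del: list_encode.simps(2))
  qed (simp add: d)
  show ?thesis
  proof (rule exI[of _ "\<lambda>t v. if d i v = 0 then 0 else Suc (pfst (d i v - 1))"], rule clocksI)
    fix xs y
    show "eval (Proj i) xs y \<longleftrightarrow> (\<exists>t::nat. (if d i (list_encode xs) = 0 then 0
        else Suc (pfst (d i (list_encode xs) - 1))) = Suc y)"
    proof (cases "i < length xs")
      case True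
      then have "drop i xs = xs ! i # drop (Suc i) xs" by (rule Cons_nth_drop_Suc[symmetric])
      with True show ?thesis
        by (auto simp: eval_Proj_iff drop list_encode_Cons_pair simp del: list_encode.simps(2))
    qed (simp add: eval_Proj_iff drop)
  qed (auto intro!: computable_basic computable_compose[OF comp])
qed

text \<open>The argument values are collected into one list code, which is the input format of the
  clock of the outer function in a composition.\<close>

lemma clocks_list_all2:
  assumes "\<And>g. g \<in> set gs \<Longrightarrow> \<exists>S. clocks S (eval g)"
  shows "\<exists>S. clocks S (\<lambda>xs v. \<exists>ys. list_all2 (\<lambda>g y. eval g xs y) gs ys \<and> v = list_encode ys)"
  using assms
proof (induction gs)
  case Nil
  show ?case
    by (rule exI[of _ "\<lambda>t v. Suc 0"], rule clocksI) (auto intro: computable_const)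
next
  case (Cons g gs)
  obtain S where S: "clocks S (eval g)" using Cons.prems by auto
  obtain S' where
    S': "clocks S' (\<lambda>xs v. \<exists>ys. list_all2 (\<lambda>g y. eval g xs y) gs ys \<and> v = list_encode ys)"
    using Cons by auto
  \<comment> \<open>One \<open>Suc\<close> belongs to the code of a nonempty list, the other one
    signals that the computation has finished.\<close>
  let ?S = "\<lambda>t v. if S t v = 0 then 0 else if S' t v = 0 then 0
      else Suc (Suc (pair (S t v - 1) (S' t v - 1)))"
  have eq: "?S t v = Suc w \<longleftrightarrow> (\<exists>y z. S t v = Suc y \<and> S' t v = Suc z \<and> w = Suc (pair y z))" for t v w
    by (cases "S t v"; cases "S' t v") auto
  show ?case
  proof (rule exI[of _ ?S], rule clocksI)
    show "computable (\<lambda>z. ?S (pfst z) (psnd z))"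
      by (intro computable_basic clocks_computable[OF S] clocks_computable[OF S'])
    show "?S t' v = Suc y" if "?S t v = Suc y" "t \<le> t'" for t t' v y
      using that clocks_mono[OF S] clocks_mono[OF S'] unfolding eq by blast
    fix xs w
    have "(\<exists>ys. list_all2 (\<lambda>g y. eval g xs y) (g # gs) ys \<and> w = list_encode ys) \<longleftrightarrow>
        (\<exists>y z. w = Suc (pair y z) \<and> eval g xs y \<and>
           (\<exists>ys. list_all2 (\<lambda>g y. eval g xs y) gs ys \<and> z = list_encode ys))"
      unfolding list_all2_Cons1 by (metis list_encode_Cons_pair)
    also have "\<dots> \<longleftrightarrow> (\<exists>y z. w = Suc (pair y z) \<and>
        (\<exists>t. S t (list_encode xs) = Suc y \<and> S' t (list_encode xs) = Suc z))"
      unfolding clocks_iff[OF S] clocks_iff[OF S'] clocks_ex_conj[OF S S'] ..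
    finally show "(\<exists>ys. list_all2 (\<lambda>g y. eval g xs y) (g # gs) ys \<and> w = list_encode ys) \<longleftrightarrow>
        (\<exists>t. ?S t (list_encode xs) = Suc w)"
      unfolding eq by blast
  qed
qed

lemma clocks_Comp:
  assumes "\<exists>S. clocks S (eval f)" "\<And>g. g \<in> set gs \<Longrightarrow> \<exists>S. clocks S (eval g)"
  shows "\<exists>S. clocks S (eval (Comp f gs))"
proof -
  obtain S where S: "clocks S (eval f)" using assms(1) by auto
  obtain S' where
    S': "clocks S' (\<lambda>xs v. \<exists>ys. list_all2 (\<lambda>g y. eval g xs y) gs ys \<and> v = list_encode ys)"
    using clocks_list_all2[OF assms(2)] by blast
  let ?S = "\<lambda>t v. if S' t v = 0 then 0 else S t (S' t v - 1)"
  have eq: "?S t v = Suc y \<longleftrightarrow> (\<exists>w. S' t v = Suc w \<and> S t w = Suc y)" for t v y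
    by (cases "S' t v") auto
  show ?thesis
  proof (rule exI[of _ ?S], rule clocksI)
    show "computable (\<lambda>z. ?S (pfst z) (psnd z))"
      by (intro computable_if decidable_eq computable_compose2[OF clocks_computable[OF S]]
          computable_diff clocks_computable[OF S'] computable_const computable_pfst computable_id)
    show "?S t' v = Suc y" if "?S t v = Suc y" "t \<le> t'" for t t' v y
      using that clocks_mono[OF S] clocks_mono[OF S'] unfolding eq by blast
    fix xs y
    have "eval (Comp f gs) xs y \<longleftrightarrow>
        (\<exists>w. (\<exists>ys. list_all2 (\<lambda>g y. eval g xs y) gs ys \<and> w = list_encode ys) \<and> eval f (list_decode w) y)"
      by (auto simp: eval_Comp_iff)
    also have "\<dots> \<longleftrightarrow> (\<exists>w. \<exists>t. S' t (list_encode xs) = Suc w \<and> S t w = Suc y)"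
      unfolding clocks_iff[OF S] clocks_iff[OF S'] list_decode_inverse clocks_ex_conj[OF S' S] ..
    finally show "eval (Comp f gs) xs y \<longleftrightarrow> (\<exists>t. ?S t (list_encode xs) = Suc y)"
      unfolding eq by blast
  qed
qed

lemma clocks_Prim:
  assumes "\<exists>S. clocks S (eval f)" "\<exists>S. clocks S (eval g)"
  shows "\<exists>S. clocks S (eval (Prim f g))"
proof -
  obtain S where S: "clocks S (eval f)" using assms(1) by auto
  obtain S' where S': "clocks S' (eval g)" using assms(2) by auto
  \<comment> \<open>The whole recursion is run with the same time bound \<open>t\<close> at each
    level; a level that has not finished yields 0, and this 0 is passed on upwards.\<close>
  define Q where "Q = (\<lambda>t w n. rec_nat (S t w)
    (\<lambda>m a. if a = 0 then 0 else S' t (Suc (pair m (Suc (pair (a - 1) w))))) n)"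
  have Q0: "Q t w 0 = S t w"
    and QS: "Q t w (Suc n) = Suc y \<longleftrightarrow>
      (\<exists>a. Q t w n = Suc a \<and> S' t (Suc (pair n (Suc (pair a w)))) = Suc y)" for t w n y
    unfolding Q_def by (auto simp: gr0_conv_Suc)
  have Q_mono: "Q t w n = Suc y \<Longrightarrow> t \<le> t' \<Longrightarrow> Q t' w n = Suc y" for t t' w n y
    by (induction n arbitrary: y)
       (auto simp: Q0 QS intro: clocks_mono[OF S] clocks_mono[OF S'])
  have Q: "eval (Prim f g) (n # zs) y \<longleftrightarrow> (\<exists>t. Q t (list_encode zs) n = Suc y)" for n zs y
  proof (induction n arbitrary: y)
    case 0
    then show ?case by (simp add: eval_Prim_0_iff Q0 clocks_iff[OF S])
  next
    case (Suc n)
    have "(\<exists>t. Q t w n = Suc a) \<and> (\<exists>t. S' t v = Suc y) \<longleftrightarrow> (\<exists>t. Q t w n = Suc a \<and> S' t v = Suc y)"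
      for w v a
      using Q_mono clocks_mono[OF S'] by (meson max.cobounded1 max.cobounded2)
    then show ?case
      unfolding eval_Prim_Suc_iff Suc clocks_iff[OF S'] QS list_encode_Cons_pair by blast
  qed
  let ?S = "\<lambda>t v. if v = 0 then 0 else Q t (psnd (v - 1)) (pfst (v - 1))"
  show ?thesis
  proof (rule exI[of _ ?S], rule clocksI)
    show "computable (\<lambda>z. ?S (pfst z) (psnd z))"
      unfolding Q_def
      by (intro computable_if decidable_eq computable_const computable_rec_nat computable_Suc
          computable_compose2[OF clocks_computable[OF S]] computable_compose2[OF clocks_computable[OF S']]
          computable_pfst computable_psnd computable_pair computable_diff computable_id)
    show "?S t' v = Suc y" if "?S t v = Suc y" "t \<le> t'" for t t' v y
      using that Q_mono[of t "psnd (v - 1)" "pfst (v - 1)" y t'] by (cases "v = 0") simp_all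
    show "eval (Prim f g) xs y \<longleftrightarrow> (\<exists>t. ?S t (list_encode xs) = Suc y)" for xs y
      by (cases xs) (auto simp: eval_Prim_Nil_iff Q list_encode_Cons_pair simp del: list_encode.simps(2))
  qed
qed

lemma clocks_Mn:
  assumes "\<exists>S. clocks S (eval f)"
  shows "\<exists>S. clocks S (eval (Mn f))"
proof -
  obtain S where S: "clocks S (eval f)" using assms by auto
  \<comment> \<open>A clock value above \<open>Suc 0\<close> means that the computation has finished
    with a positive result; \<open>Suc 0\<close> means a result of zero.\<close>
  define P where "P = (\<lambda>t v n. S t (Suc (pair n v)) = Suc 0 \<and> (\<forall>m<n. Suc 0 < S t (Suc (pair m v))))"
  \<comment> \<open>At most one \<open>n\<close> satisfies \<open>P t v n\<close>, so the sum has at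
    most one nonzero term and acts as a bounded search.\<close>
  let ?S = "\<lambda>t v. \<Sum>n<t. if P t v n then Suc n else 0"
  have P_unique: "P t v n \<Longrightarrow> P t v n' \<Longrightarrow> n = n'" for t v n n'
    unfolding P_def by (metis less_irrefl linorder_neqE_nat)
  have eq: "?S t v = Suc n \<longleftrightarrow> n < t \<and> P t v n" for t v n
  proof -
    have *: "?S t v = Suc n'" if "n' < t" "P t v n'" for n'
    proof -
      have "?S t v = (\<Sum>i<t. if i = n' then Suc n' else 0)"
        by (rule sum.cong) (use that P_unique in auto)
      also have "\<dots> = Suc n'" using that by (simp only: sum.delta finite_lessThan lessThan_iff if_True)
      finally show ?thesis .
    qed
    show ?thesis
    proof
      assume sum: "?S t v = Suc n"
      have "\<exists>n'<t. P t v n'"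
      proof (rule ccontr)
        assume "\<not> (\<exists>n'<t. P t v n')"
        then have "?S t v = 0" by (intro sum.neutral) auto
        with sum show False by simp
      qed
      then obtain n' where "n' < t" "P t v n'" by blast
      with *[of n'] sum show "n < t \<and> P t v n" by simp
    qed (use * in blast)
  qed
  have P_mono: "P t v n \<Longrightarrow> t \<le> t' \<Longrightarrow> P t' v n" for t t' v n
    unfolding P_def using clocks_mono[OF S] by (metis Suc_lessE)
  show ?thesis
  proof (rule exI[of _ ?S], rule clocksI)
    have "decidable (\<lambda>z. P (pfst (pfst z)) (psnd (pfst z)) (psnd z))"
      unfolding P_def
      by (intro decidable_conj decidable_eq decidable_ball decidable_less computable_const computable_Suc
          computable_compose2[OF clocks_computable[OF S]] computable_pfst computable_psnd
          computable_pair computable_id)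
    then show "computable (\<lambda>z. ?S (pfst z) (psnd z))"
      by (intro computable_sum computable_if computable_basic)
    show "?S t' v = Suc y" if "?S t v = Suc y" "t \<le> t'" for t t' v y
      using that P_mono unfolding eq by (meson less_le_trans)
    fix xs n
    let ?v = "\<lambda>m. Suc (pair m (list_encode xs))"
    show "eval (Mn f) xs n \<longleftrightarrow> (\<exists>t. ?S t (list_encode xs) = Suc n)"
    proof
      assume "eval (Mn f) xs n"
      then obtain t0 where t0: "S t0 (?v n) = Suc 0"
        and "\<forall>m<n. \<exists>t. \<exists>y>0. S t (?v m) = Suc y"
        unfolding eval_Mn_iff clocks_iff[OF S] list_encode_Cons_pair by blast
      then obtain \<tau> where \<tau>: "\<And>m. m < n \<Longrightarrow> \<exists>y>0. S (\<tau> m) (?v m) = Suc y" by metis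
      \<comment> \<open>This bound exceeds \<open>n\<close> and dominates the times of all
        \<open>n + 1\<close> computations involved.\<close>
      define t where "t = Suc n + t0 + (\<Sum>m<n. \<tau> m)"
      have "\<tau> m \<le> t" if "m < n" for m
        using member_le_sum[of m "{..<n}" \<tau>] that by (simp add: t_def)
      then have "\<exists>y>0. S t (?v m) = Suc y" if "m < n" for m
        using \<tau>[OF that] clocks_mono[OF S] that by blast
      moreover have "S t (?v n) = Suc 0"
        using clocks_mono[OF S t0] by (simp add: t_def)
      ultimately have "P t (list_encode xs) n" unfolding P_def by fastforce
      moreover have "n < t" by (simp add: t_def)
      ultimately show "\<exists>t. ?S t (list_encode xs) = Suc n" unfolding eq by blast
    next
      assume "\<exists>t. ?S t (list_encode xs) = Suc n"
      then obtain t where t: "P t (list_encode xs) n" unfolding eq by blast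
      then have "\<exists>y>0. S t (?v m) = Suc y" if "m < n" for m
        using that unfolding P_def by (metis Suc_less_eq2)
      with t show "eval (Mn f) xs n"
        unfolding eval_Mn_iff clocks_iff[OF S] list_encode_Cons_pair P_def by blast
    qed
  qed
qed

text \<open>Halting within a given time thereby becomes decidable, which permits dovetailing over
  all inputs.\<close>

lemma ex_clock: "\<exists>S. clocks S (eval r)"
  by (induction r)
     (auto intro: clocks_Zf clocks_Sf clocks_Proj clocks_Prim clocks_Mn intro!: clocks_Comp)

section \<open>Binary strings\<close>

lemma dec_bl_enc_bl [simp]: "dec_bl (enc_bl s) = s"
  by (induction s) auto

lemma enc_bl_dec_bl [simp]: "enc_bl (dec_bl n) = n"
proof (induction n rule: dec_bl.induct)
  case (2 n)
  have "2 * (n div 2) + (if odd n then 1 else 0) = n"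
    using mult_div_mod_eq[of 2 n] by (simp add: odd_iff_mod_2_eq_one even_iff_mod_2_eq_zero)
  with 2 show ?case by simp
qed simp

lemma inj_enc_bl: "inj_on enc_bl A"
  by (rule inj_on_inverseI[of _ dec_bl]) simp

lemma enc_bl_append: "enc_bl (p @ q) = enc_bl p + 2 ^ length p * enc_bl q"
  by (induction p) (auto simp: algebra_simps)

lemma enc_bl_lower: "2 ^ length s \<le> Suc (enc_bl s)"
  by (induction s) auto

lemma enc_bl_upper: "Suc (enc_bl s) < 2 ^ Suc (length s)"
  by (induction s) auto

definition blen :: "nat \<Rightarrow> nat" where "blen y = length (dec_bl y)"

lemma blen_enc_bl [simp]: "blen (enc_bl s) = length s"
  by (simp add: blen_def)

text \<open>Strings of length L have exactly the codes from 2^L - 1 to 2^(L+1) - 2, so the length is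
  a rounded logarithm and can be computed from powers of two.\<close>

lemma le_blen_iff: "i \<le> blen y \<longleftrightarrow> 2 ^ i \<le> Suc y"
proof
  assume "i \<le> blen y"
  then have "(2::nat) ^ i \<le> 2 ^ blen y" by simp
  also have "\<dots> \<le> Suc y" using enc_bl_lower[of "dec_bl y"] by (simp add: blen_def)
  finally show "2 ^ i \<le> Suc y" .
next
  assume "2 ^ i \<le> Suc y"
  also have "Suc y < 2 ^ Suc (blen y)"
    using enc_bl_upper[of "dec_bl y"] by (simp add: blen_def)
  finally have "i < Suc (blen y)" by (rule power_less_imp_less_exp[rotated]) simp
  then show "i \<le> blen y" by simp
qed

lemma blen_le: "blen y \<le> y"
proof -
  have "blen y < 2 ^ blen y" by (rule less_exp)
  also have "2 ^ blen y \<le> Suc y" using le_blen_iff by blast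
  finally show ?thesis by simp
qed

lemma computable_blen: "computable f \<Longrightarrow> computable (\<lambda>x. blen (f x))"
proof (rule computable_compose[of blen])
  have "blen y = (\<Sum>i<y. if 2 ^ Suc i \<le> Suc y then 1 else 0)" for y
  proof -
    have "(\<Sum>i<y. if 2 ^ Suc i \<le> Suc y then 1 else 0 :: nat) = card {i. i < y \<and> Suc i \<le> blen y}"
      unfolding le_blen_iff[symmetric] by (simp add: sum.If_cases Int_def)
    also have "{i. i < y \<and> Suc i \<le> blen y} = {..<blen y}" using blen_le[of y] by auto
    finally show ?thesis by simp
  qed
  then have *: "blen = (\<lambda>y. \<Sum>i<y. if 2 ^ Suc i \<le> Suc y then 1 else 0)" by auto
  show "computable blen"
    unfolding * by (intro computable_sum computable_basic)
qed

lemma partial_recursive_bl_search: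
  assumes "decidable (\<lambda>z. R (pfst z) (psnd z))" "computable out"
  shows "partial_recursive_bl (\<lambda>p. if \<exists>z. R (enc_bl p) z
    then Some (dec_bl (out (LEAST z. R (enc_bl p) z))) else None)"
proof -
  have "(\<lambda>n. map_option enc_bl (if \<exists>z. R (enc_bl (dec_bl n)) z
      then Some (dec_bl (out (LEAST z. R (enc_bl (dec_bl n)) z))) else None)) =
    (\<lambda>x. if \<exists>z. R x z then Some (out (LEAST z. R x z)) else None)"
    by auto
  then show ?thesis
    unfolding partial_recursive_bl_def using partial_recursive_search[OF assms] by simp
qed

section \<open>Compressible strings\<close>

text \<open>Induction on a bound for the lengths: unless the empty string is a member, the set
  splits by the first bit. Removing that bit leaves prefix-free sets of shorter strings, each of
  which contributes half of its own sum.\<close>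

lemma kraft_inequality:
  assumes "finite P" "prefix_free_set P"
  shows "(\<Sum>p\<in>P. (1/2::real) ^ length p) \<le> 1"
proof -
  have "\<lbrakk>finite P; prefix_free_set P; \<forall>p\<in>P. length p \<le> N\<rbrakk> \<Longrightarrow> (\<Sum>p\<in>P. (1/2::real) ^ length p) \<le> 1"
    for P N
  proof (induction N arbitrary: P)
    case 0
    then have "P = {} \<or> P = {[]}" by auto
    then show ?case by auto
  next
    case (Suc N)
    show ?case
    proof (cases "[] \<in> P")
      case True
      then have "p = []" if "p \<in> P" for p
        using Suc.prems(2) that unfolding prefix_free_set_def by (metis append_Nil)
      with True have "P = {[]}" by blast
      then show ?thesis by simp
    next
      case False
      define Q where "Q = (\<lambda>b. {p. b # p \<in> P})"
      have fin: "finite (Q b)" for b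
        using finite_vimageI[OF Suc.prems(1), of "(#) b"] by (simp add: Q_def vimage_def)
      have Q: "(\<Sum>p\<in>Q b. (1/2::real) ^ length p) \<le> 1" for b
      proof (rule Suc.IH[OF fin])
        show "prefix_free_set (Q b)"
          using Suc.prems(2) unfolding prefix_free_set_def Q_def by (metis append_Cons mem_Collect_eq)
        show "\<forall>p\<in>Q b. length p \<le> N" using Suc.prems(3) unfolding Q_def by force
      qed
      have "P = (#) True ` Q True \<union> (#) False ` Q False"
      proof (intro set_eqI iffI)
        fix p assume "p \<in> P"
        then show "p \<in> (#) True ` Q True \<union> (#) False ` Q False"
          using False by (cases p; cases "hd p") (auto simp: Q_def)
      qed (auto simp: Q_def)
      moreover have "(#) True ` Q True \<inter> (#) False ` Q False = {}" by auto
      ultimately have "(\<Sum>p\<in>P. (1/2::real) ^ length p) =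
          (\<Sum>p\<in>(#) True ` Q True. (1/2) ^ length p) + (\<Sum>p\<in>(#) False ` Q False. (1/2) ^ length p)"
        using fin by (metis sum.union_disjoint finite_imageI)
      also have "\<dots> = (1/2) * (\<Sum>p\<in>Q True. (1/2) ^ length p) + (1/2) * (\<Sum>p\<in>Q False. (1/2) ^ length p)"
        by (simp add: sum.reindex sum_distrib_left)
      also have "\<dots> \<le> 1" using Q[of True] Q[of False] by simp
      finally show ?thesis .
    qed
  qed
  from this[OF assms, of "Max (length ` P)"] show ?thesis using assms(1) by simp
qed

section \<open>Weight, enumerability and infinitude of the set of compressible strings\<close>

lemma Theta_set_iff: "s \<in> Theta_set V \<longleftrightarrow> (\<exists>p. V p = Some s \<and> length p < length s)"
  by (auto simp: Theta_set_def HC_def INF_less_iff)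

text \<open>Each string is replaced by a shorter program for it, which only increases its term.
  Distinct strings have distinct programs, and Kraft's inequality bounds the sum over these.\<close>

lemma sum_Theta_set_le_1:
  assumes "prefix_free_set (dom V)" "finite F" "F \<subseteq> Theta_set V"
  shows "(\<Sum>s\<in>F. (1/2::real) ^ length s) \<le> 1"
proof -
  obtain p where p: "\<And>s. s \<in> F \<Longrightarrow> V (p s) = Some s \<and> length (p s) < length s"
    using assms(3) unfolding subset_iff Theta_set_iff by metis
  have "inj_on p F" by (rule inj_onI) (metis p option.inject)
  have "(\<Sum>s\<in>F. (1/2::real) ^ length s) \<le> (\<Sum>s\<in>F. (1/2) ^ length (p s))"
    using p by (intro sum_mono power_decreasing) (auto intro: less_imp_le)
  also have "\<dots> = (\<Sum>q\<in>p ` F. (1/2) ^ length q)"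
    by (simp add: sum.reindex[OF \<open>inj_on p F\<close>])
  also have "\<dots> \<le> 1"
  proof (rule kraft_inequality)
    have "p ` F \<subseteq> dom V" using p by auto
    then show "prefix_free_set (p ` F)"
      using assms(1) unfolding prefix_free_set_def by blast
  qed (use assms(2) in simp)
  finally show ?thesis .
qed

lemma Theta_set_enumerable:
  assumes "partial_recursive_bl V"
  shows "\<exists>E. decidable (\<lambda>z. E (pfst z) (psnd z)) \<and> (\<forall>k y. E k y \<longrightarrow> y < k) \<and>
    (\<forall>k k' y. E k y \<longrightarrow> k \<le> k' \<longrightarrow> E k' y) \<and> (\<forall>y. dec_bl y \<in> Theta_set V \<longleftrightarrow> (\<exists>k. E k y))"
proof -
  obtain r where r: "\<And>x y. eval r [x] y \<longleftrightarrow> map_option enc_bl (V (dec_bl x)) = Some y"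
    using assms unfolding partial_recursive_bl_def partial_recursive_def by blast
  obtain S where S: "clocks S (eval r)" using ex_clock by blast
  \<comment> \<open>One number \<open>k\<close> bounds the code of the string, the code of the
    program and the running time; this makes each stage finite and decidable, and the stages
    increasing.\<close>
  define E where "E = (\<lambda>k y. y < k \<and> (\<exists>x<k. S k (Suc (pair x 0)) = Suc y \<and> blen x < blen y))"
  have code: "list_encode [x] = Suc (pair x 0)" for x by (simp add: pair_def)
  have V: "V (dec_bl x) = Some (dec_bl y) \<longleftrightarrow> (\<exists>t. S t (Suc (pair x 0)) = Suc y)" for x y
  proof -
    have "V (dec_bl x) = Some (dec_bl y) \<longleftrightarrow> map_option enc_bl (V (dec_bl x)) = Some y"
      by (auto simp: map_option_eq_Some)
    then show ?thesis by (simp only: r[symmetric] clocks_iff[OF S] code)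
  qed
  show ?thesis
  proof (intro exI[of _ E] conjI allI impI)
    show "decidable (\<lambda>z. E (pfst z) (psnd z))"
      unfolding E_def
      by (intro decidable_conj decidable_less decidable_bex decidable_eq computable_blen
          computable_compose2[OF clocks_computable[OF S]] computable_Suc computable_pair
          computable_pfst computable_psnd computable_id computable_const)
    show "y < k" if "E k y" for k y using that by (simp add: E_def)
    show "E k' y" if "E k y" "k \<le> k'" for k k' y
      using that clocks_mono[OF S] unfolding E_def by (meson less_le_trans)
    show "dec_bl y \<in> Theta_set V \<longleftrightarrow> (\<exists>k. E k y)" for y
    proof
      assume "dec_bl y \<in> Theta_set V"
      then obtain p where p: "V p = Some (dec_bl y)" "length p < blen y"
        unfolding Theta_set_iff blen_def by blast
      then obtain t where t: "S t (Suc (pair (enc_bl p) 0)) = Suc y"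
        using V[of "enc_bl p" y] by auto
      define k where "k = t + Suc y + Suc (enc_bl p)"
      have "S k (Suc (pair (enc_bl p) 0)) = Suc y"
        by (rule clocks_mono[OF S t]) (simp add: k_def)
      then have "E k y"
        unfolding E_def using p(2) by (auto simp: k_def intro!: exI[of _ "enc_bl p"])
      then show "\<exists>k. E k y" ..
    next
      assume "\<exists>k. E k y"
      then obtain k x where "S k (Suc (pair x 0)) = Suc y" "blen x < blen y"
        unfolding E_def by blast
      then show "dec_bl y \<in> Theta_set V"
        using V[of x y] unfolding Theta_set_iff blen_def by blast
    qed
  qed
qed

lemma enc_bl_replicate_True: "enc_bl (replicate a True) + 2 = 2 * 2 ^ a"
  by (induction a) auto

lemma replicate_True_False_eqD:
  assumes "replicate a True @ False # u = replicate b True @ False # v"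
  shows "a = b \<and> u = v"
  using assms
proof (induction a arbitrary: b)
  case 0
  then show ?case by (cases b) auto
next
  case (Suc a)
  then show ?case by (cases b) auto
qed

text \<open>The machine mapping \<open>1\<^sup>a0\<close> to a string of length \<open>2a\<close> yields arbitrarily long compressible
  strings.\<close>

lemma infinite_Theta_set:
  assumes "optimal_machine V"
  shows "infinite (Theta_set V)"
proof
  assume fin: "finite (Theta_set V)"
  \<comment> \<open>The program consisting of \<open>a\<close> ones and a zero has the code 3 * 2^a
    - 2.\<close>
  define R where "R = (\<lambda>x a. x + 2 = (3 * 2 ^ a :: nat))"
  define C where "C = (\<lambda>p. if \<exists>z. R (enc_bl p) z
    then Some (dec_bl (2 ^ (2 * (LEAST z. R (enc_bl p) z)) - 1)) else None)"
  have enc: "enc_bl (replicate a True @ [False]) + 2 = 3 * 2 ^ a" for a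
    using enc_bl_replicate_True[of a] by (simp add: enc_bl_append)
  have R: "R (enc_bl p) a \<longleftrightarrow> p = replicate a True @ [False]" for p a
    unfolding R_def enc[of a, symmetric] add_right_cancel by (metis dec_bl_enc_bl)
  have C: "C (replicate a True @ [False]) = Some (dec_bl (2 ^ (2 * a) - 1))" for a
  proof -
    have "R (enc_bl (replicate a True @ [False])) = (\<lambda>z. z = a)"
      unfolding fun_eq_iff R using replicate_True_False_eqD by blast
    moreover have "(LEAST z. z = a) = a" by (rule Least_equality) auto
    ultimately show ?thesis by (simp add: C_def)
  qed
  have "prefix_free_machine C"
    unfolding prefix_free_machine_def
  proof
    show "partial_recursive_bl C"
      unfolding C_def R_def by (intro partial_recursive_bl_search computable_basic)
    have dom: "\<exists>a. p = replicate a True @ [False]" if "p \<in> dom C" for p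
      using that by (auto simp: C_def R split: if_splits)
    show "prefix_free_set (dom C)"
      unfolding prefix_free_set_def
    proof (intro ballI allI impI)
      fix p q r assume "p \<in> dom C" "q \<in> dom C" and eq: "q = p @ r"
      then obtain a b where "p = replicate a True @ [False]" "q = replicate b True @ [False]"
        using dom by blast
      with eq have "replicate b True @ False # [] = replicate a True @ False # r" by simp
      then show "r = []" by (auto dest: replicate_True_False_eqD)
    qed
  qed
  then obtain d where d: "\<And>p. p \<in> dom C \<Longrightarrow> \<exists>q\<in>dom V. V q = C p \<and> length q \<le> length p + d"
    using assms unfolding optimal_machine_def by blast
  \<comment> \<open>The number 2^(2a) - 1 is the least code of a string of length 2a.\<close>
  have len: "length (dec_bl (2 ^ (2 * a) - 1)) = 2 * a" for a
  proof -
    have "i \<le> blen (2 ^ (2 * a) - 1) \<longleftrightarrow> i \<le> 2 * a" for i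
      unfolding le_blen_iff by simp
    then show ?thesis unfolding blen_def[symmetric] by (metis order_antisym order_refl)
  qed
  \<comment> \<open>The program in \<open>V\<close> has length at most a + 1 + d, which is below 2a
    as soon as a > d + 1.\<close>
  have "dec_bl (2 ^ (2 * a) - 1) \<in> Theta_set V" if "a > d + 1" for a
  proof -
    have "replicate a True @ [False] \<in> dom C" using C[of a] by blast
    from d[OF this] obtain q where "V q = Some (dec_bl (2 ^ (2 * a) - 1))" "length q \<le> Suc a + d"
      by (auto simp: C)
    then show ?thesis unfolding Theta_set_iff len using that by (intro exI[of _ q]) auto
  qed
  then have "(\<lambda>a. dec_bl (2 ^ (2 * a) - 1)) ` {d + 1<..} \<subseteq> Theta_set V" by auto
  then have "finite ((\<lambda>a. dec_bl (2 ^ (2 * a) - 1)) ` {d + 1<..})"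
    using fin finite_subset by blast
  moreover have "inj_on (\<lambda>a. dec_bl (2 ^ (2 * a) - 1)) {d + 1<..}"
    by (rule inj_onI) (metis len mult_cancel1 zero_neq_numeral)
  ultimately show False using finite_imageD infinite_Ioi by blast
qed

section \<open>Sums of powers\<close>

text \<open>With S the total, each term is x * x^(p-1), which is at most x * S^(p-1); summing these
  bounds gives S * S^(p-1).\<close>

lemma sum_powr_le_powr_sum:
  fixes x :: "'a \<Rightarrow> real"
  assumes "finite F" "\<And>i. i \<in> F \<Longrightarrow> 0 \<le> x i" "1 \<le> p"
  shows "(\<Sum>i\<in>F. x i powr p) \<le> (\<Sum>i\<in>F. x i) powr p"
proof -
  define S where "S = (\<Sum>i\<in>F. x i)"
  have "0 \<le> S" using assms(2) by (simp add: S_def sum_nonneg)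
  have "x i powr p \<le> x i * S powr (p - 1)" if "i \<in> F" for i
  proof -
    have "x i \<le> S" unfolding S_def using assms that by (intro member_le_sum) auto
    then have "x i powr (p - 1) \<le> S powr (p - 1)" using assms that by (intro powr_mono2) auto
    then have "x i * x i powr (p - 1) \<le> x i * S powr (p - 1)"
      using assms(2)[OF that] by (rule mult_left_mono)
    then show ?thesis using powr_mult_base[OF assms(2)[OF that], of "p - 1"] by simp
  qed
  then have "(\<Sum>i\<in>F. x i powr p) \<le> (\<Sum>i\<in>F. x i * S powr (p - 1))" by (rule sum_mono)
  also have "\<dots> = S * S powr (p - 1)" by (simp add: S_def sum_distrib_right)
  also have "\<dots> = S powr p" using powr_mult_base[OF \<open>0 \<le> S\<close>, of "p - 1"] by simp
  finally show ?thesis by (simp add: S_def)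
qed

text \<open>Any finite set outside \<open>F\<close> has \<open>x\<close>-sum at most
  \<open>e\<close>, so by superadditivity its sum of powers is at most \<open>e powr p\<close>. This
  carries a tail estimate for \<open>beta\<close> over to \<open>theta\<close>.\<close>

lemma infsum_powr_le_finite_sum:
  fixes x :: "'a \<Rightarrow> real"
  assumes "x summable_on A" "(\<lambda>i. x i powr p) summable_on A" "\<And>i. 0 \<le> x i" "1 \<le> p"
    and "finite F" "F \<subseteq> A" "infsum x A \<le> sum x F + e"
  shows "infsum (\<lambda>i. x i powr p) A \<le> (\<Sum>i\<in>F. x i powr p) + e powr p"
proof (rule infsum_le_finite_sums[OF assms(2)])
  fix G assume G: "finite G" "G \<subseteq> A"
  have "sum x F + sum x (G - F) = sum x (F \<union> G)"
    using assms(5) G by (subst sum.union_disjoint[symmetric]) auto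
  also have "\<dots> \<le> infsum x A"
    using assms G by (intro finite_sum_le_infsum) auto
  finally have "sum x (G - F) \<le> e" using assms(7) by simp
  moreover have "0 \<le> sum x (G - F)" using assms(3) by (simp add: sum_nonneg)
  ultimately have "sum x (G - F) powr p \<le> e powr p" using assms(4) by (intro powr_mono2) auto
  with sum_powr_le_powr_sum[of "G - F" x p] G assms(3,4)
  have "(\<Sum>i\<in>G - F. x i powr p) \<le> e powr p" by simp
  moreover have "(\<Sum>i\<in>G. x i powr p) \<le> (\<Sum>i\<in>F \<union> (G - F). x i powr p)"
    using assms(5) G by (intro sum_mono2) auto
  moreover have "\<dots> = (\<Sum>i\<in>F. x i powr p) + (\<Sum>i\<in>G - F. x i powr p)"
    using assms(5) G by (intro sum.union_disjoint) auto
  ultimately show "(\<Sum>i\<in>G. x i powr p) \<le> (\<Sum>i\<in>F. x i powr p) + e powr p" by linarith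
qed

text \<open>The tangent inequality for exp bounds the gap below by c * (1/T - 1/t). For large
  \<open>n\<close> this first forces t \<le> 2T, and with that bound it becomes linear in t -
  T.\<close>

lemma exponential_gap_bound:
  fixes T :: real and L :: nat
  assumes "0 < T" "0 < L"
  obtains K N :: nat where
    "\<And>n t. N \<le> n \<Longrightarrow> T \<le> t \<Longrightarrow> 2 powr (- real L / t) - 2 powr (- real L / T) \<le> (1/2) ^ n
      \<Longrightarrow> t - T \<le> real K * (1/2) ^ n"
proof -
  \<comment> \<open>This is the absolute slope of 2^(-L s) as a function of s at s = 1/T.\<close>
  define c where "c = real L * ln 2 * 2 powr (- real L / T)"
  have c: "0 < c" using assms by (simp add: c_def)
  obtain N where N: "(1/2::real) ^ N < c / (2 * T)"
    using real_arch_pow_inv[of "c / (2 * T)" "1/2"] c assms by auto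
  obtain K :: nat where K: "2 * T\<^sup>2 / c \<le> real K" using real_arch_simple by blast
  show ?thesis
  proof
    fix n t
    assume n: "N \<le> n" and t: "T \<le> t"
      and gap: "2 powr (- real L / t) - 2 powr (- real L / T) \<le> (1/2) ^ n"
    let ?e = "(1/2::real) ^ n"
    have t0: "0 < t" using t assms by simp
    have "2 powr (- real L / t) = 2 powr (- real L / T) * 2 powr (real L * (1 / T - 1 / t))"
      by (simp add: powr_add[symmetric] field_simps)
    also have "2 powr (real L * (1 / T - 1 / t)) = exp (real L * (1 / T - 1 / t) * ln 2)"
      by (simp add: powr_def)
    also have "2 powr (- real L / T) * \<dots> \<ge>
        2 powr (- real L / T) * (1 + real L * (1 / T - 1 / t) * ln 2)"
      by (intro mult_left_mono exp_ge_add_one_self) simp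
    finally have "c * (1 / T - 1 / t) \<le> ?e"
      using gap by (simp add: c_def algebra_simps)
    then have "c * (t - T) \<le> ?e * (t * T)"
      using assms t0 by (simp add: field_simps)
    then have *: "t - T \<le> ?e / c * (t * T)" using c by (simp add: field_simps)
    have "?e \<le> (1/2) ^ N" using n by (intro power_decreasing) auto
    also have "\<dots> \<le> c / (2 * T)" using N by simp
    finally have "?e / c * T \<le> 1/2" using c assms by (simp add: field_simps)
    then have "?e / c * T * t \<le> 1/2 * t" using t0 by (intro mult_right_mono) auto
    moreover have "?e / c * T * t = ?e / c * (t * T)" by (simp add: ac_simps)
    ultimately have "t \<le> 2 * T" using * by linarith
    then have "?e / c * (t * T) \<le> ?e / c * (2 * T * T)"
      using c assms by (intro mult_left_mono mult_right_mono) auto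
    also have "\<dots> = 2 * T\<^sup>2 / c * ?e" by (simp add: power2_eq_square)
    also have "\<dots> \<le> real K * ?e" using K by (intro mult_right_mono) auto
    finally show "t - T \<le> real K * ?e" using * by simp
  qed
qed

section \<open>Certified approximation of the temperature\<close>

lemma int_encode_nonneg: "0 \<le> i \<Longrightarrow> int_encode i = 2 * nat i"
  by (simp add: int_encode_def sum_encode_def)

lemma int_encode_neg: "i < 0 \<Longrightarrow> int_encode i = 2 * nat (- i - 1) + 1"
  by (simp add: int_encode_def sum_encode_def)

definition code_num :: "nat \<Rightarrow> nat" where "code_num e = (pfst e + 1) div 2"
definition code_den :: "nat \<Rightarrow> nat" where "code_den e = psnd e div 2"

text \<open>A numerator has an odd code iff it is negative, so \<open>code_num\<close> is its absolute value.\<close>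

lemma
  shows code_den_rat_enc_pos: "0 < code_den (rat_enc q)"
    and odd_rat_enc_iff: "odd (pfst (rat_enc q)) \<longleftrightarrow> q < 0"
    and code_num_rat_enc: "real (code_num (rat_enc q)) / real (code_den (rat_enc q)) = \<bar>of_rat q\<bar>"
proof -
  obtain a b where ab: "quotient_of q = (a, b)" by (cases "quotient_of q")
  have b: "0 < b" using quotient_of_denom_pos[OF ab] .
  have q: "q = of_int a / of_int b" using quotient_of_div[OF ab] .
  have fst: "pfst (rat_enc q) = int_encode a" and snd: "psnd (rat_enc q) = int_encode b"
    using ab by (simp_all add: rat_enc_def pfst_def psnd_def)
  have den: "code_den (rat_enc q) = nat b" using b by (simp add: code_den_def snd int_encode_nonneg)
  have num: "code_num (rat_enc q) = nat \<bar>a\<bar>"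
    unfolding code_num_def fst by (cases "0 \<le> a") (auto simp: int_encode_nonneg int_encode_neg)
  show "0 < code_den (rat_enc q)" using b den by simp
  have "q < 0 \<longleftrightarrow> a < 0" using b by (simp add: q divide_less_0_iff)
  then show "odd (pfst (rat_enc q)) \<longleftrightarrow> q < 0"
    unfolding fst by (cases "0 \<le> a") (auto simp: int_encode_nonneg int_encode_neg)
  show "real (code_num (rat_enc q)) / real (code_den (rat_enc q)) = \<bar>of_rat q\<bar>"
  proof -
    have "\<bar>of_rat q :: real\<bar> = real_of_int \<bar>a\<bar> / real_of_int b"
      using b by (simp add: q of_rat_divide abs_divide)
    then show ?thesis using b by (simp add: num den)
  qed
qed

lemma computable_code_num: "computable f \<Longrightarrow> computable (\<lambda>x. code_num (f x))"
  unfolding code_num_def by (intro computable_div computable_add computable_pfst computable_const)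

lemma computable_code_den: "computable f \<Longrightarrow> computable (\<lambda>x. code_den (f x))"
  unfolding code_den_def by (intro computable_div computable_psnd computable_const)

text \<open>Taking \<open>a\<close>-th powers removes the fractional exponent. For an approximation
  a/b of the temperature, this decides by integers whether u/D exceeds 2^(-1/(a/b)).\<close>

lemma powr_less_quotient_iff:
  fixes a b u D :: nat
  assumes "0 < D" "0 < a"
  shows "D ^ a < u ^ a * 2 ^ b \<longleftrightarrow> 2 powr (- (real b / real a)) < real u / real D"
proof -
  have "(2 powr (- (real b / real a))) ^ a = 2 powr (- real b)"
    using assms by (simp add: powr_power)
  also have "\<dots> = 1 / 2 ^ b" by (simp add: powr_minus_divide powr_realpow)
  finally have eq: "(2 powr (- (real b / real a))) ^ a = 1 / 2 ^ b" .
  have "2 powr (- (real b / real a)) < real u / real D \<longleftrightarrow>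
      (2 powr (- (real b / real a))) ^ a < (real u / real D) ^ a"
    unfolding not_le[symmetric] using assms by (subst power_mono_iff) auto
  also have "\<dots> \<longleftrightarrow> real (D ^ a) < real (u ^ a * 2 ^ b)"
    unfolding eq using assms by (simp add: power_divide field_simps)
  also have "\<dots> \<longleftrightarrow> D ^ a < u ^ a * 2 ^ b" by (rule of_nat_less_iff)
  finally show ?thesis by simp
qed

text \<open>Strings are represented by their codes: \<open>A\<close> stands for the compressible
  ones and \<open>E k\<close> for those found by stage \<open>k\<close>. The rationals
  \<open>f m\<close> tend to \<open>T\<close> from above, and \<open>h l\<close> tends from above to
  the negative of the value of Theta at \<open>T\<close>.\<close>

locale temperature =
  fixes T :: real and E :: "nat \<Rightarrow> nat \<Rightarrow> bool" and f h :: "nat \<Rightarrow> rat" and A :: "nat set"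
  assumes T_pos: "0 < T" and T_less_1: "T < 1"
    and E_decidable: "decidable (\<lambda>z. E (pfst z) (psnd z))"
    and E_bound: "E k y \<Longrightarrow> y < k"
    and E_mono: "E k y \<Longrightarrow> k \<le> k' \<Longrightarrow> E k' y"
    and A_iff: "y \<in> A \<longleftrightarrow> (\<exists>k. E k y)"
    and infinite_A: "infinite A"
    and kraft_A: "finite F \<Longrightarrow> F \<subseteq> A \<Longrightarrow> (\<Sum>y\<in>F. (1/2::real) ^ blen y) \<le> 1"
    and summable_A: "(\<lambda>y. 2 powr (- real (blen y) / T)) summable_on A"
    and f_recursive: "total_recursive_rat_seq f"
    and f_ge: "T \<le> of_rat (f m)"
    and f_lim: "(\<lambda>m. of_rat (f m)) \<longlonglongrightarrow> T"
    and h_recursive: "total_recursive_rat_seq h"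
    and h_ge: "- (\<Sum>\<^sub>\<infinity>y\<in>A. 2 powr (- real (blen y) / T)) \<le> of_rat (h l)"
    and h_lim: "(\<lambda>l. of_rat (h l)) \<longlonglongrightarrow> - (\<Sum>\<^sub>\<infinity>y\<in>A. 2 powr (- real (blen y) / T))"
begin

section \<open>Finite stages and their limits\<close>

definition stage :: "nat \<Rightarrow> nat set" where "stage k = {y. E k y}"

definition beta :: real where "beta = (\<Sum>\<^sub>\<infinity>y\<in>A. (1/2) ^ blen y)"
definition theta :: real where "theta = (\<Sum>\<^sub>\<infinity>y\<in>A. 2 powr (- real (blen y) / T))"

lemma finite_stage: "finite (stage k)"
  by (rule finite_subset[of _ "{..<k}"]) (auto simp: stage_def dest: E_bound)

lemma stage_subset: "stage k \<subseteq> A"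
  by (auto simp: stage_def A_iff)

lemma summable_half_powers: "(\<lambda>y. (1/2::real) ^ blen y) summable_on A"
  using kraft_A by (intro nonneg_bdd_above_summable_on bdd_aboveI[of _ 1]) auto

lemma beta_le_1: "beta \<le> 1"
  unfolding beta_def using kraft_A by (intro infsum_le_finite_sums[OF summable_half_powers]) auto

lemma finite_subset_stage:
  assumes "finite F" "F \<subseteq> A" shows "\<exists>k. F \<subseteq> stage k"
  using assms
proof (induction F rule: finite_induct)
  case (insert y F)
  then obtain k k' where "F \<subseteq> stage k" "E k' y" by (auto simp: A_iff)
  then have "insert y F \<subseteq> stage (max k k')"
    by (auto simp: stage_def intro: E_mono)
  then show ?case ..
qed simp

text \<open>This is the stage sum at the ratio u/D multiplied by D^k. The subtraction is not
  truncated, since members of stage \<open>k\<close> have length below \<open>k\<close>.\<close>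

definition psum :: "nat \<Rightarrow> nat \<Rightarrow> nat \<Rightarrow> nat" where
  "psum k u D = (\<Sum>y<k. if E k y then u ^ blen y * D ^ (k - blen y) else 0)"

lemma psum_eq:
  assumes "0 < D"
  shows "real (psum k u D) = (\<Sum>y\<in>stage k. (real u / real D) ^ blen y) * real D ^ k"
proof -
  have "real (psum k u D) = (\<Sum>y\<in>{..<k}. if E k y then real u ^ blen y * real D ^ (k - blen y) else 0)"
    unfolding psum_def of_nat_sum by (intro sum.cong) auto
  also have "\<dots> = (\<Sum>y\<in>{y\<in>{..<k}. E k y}. real u ^ blen y * real D ^ (k - blen y))"
    by (rule sum.inter_filter[symmetric]) simp
  also have "{y\<in>{..<k}. E k y} = stage k" by (auto simp: stage_def dest: E_bound)
  also have "(\<Sum>y\<in>stage k. real u ^ blen y * real D ^ (k - blen y)) =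
      (\<Sum>y\<in>stage k. (real u / real D) ^ blen y * real D ^ k)"
  proof (rule sum.cong[OF refl])
    fix y assume "y \<in> stage k"
    then have "blen y \<le> k" using blen_le[of y] E_bound[of k y] by (simp add: stage_def)
    then show "real u ^ blen y * real D ^ (k - blen y) = (real u / real D) ^ blen y * real D ^ k"
      using assms by (simp add: power_divide power_diff)
  qed
  finally show ?thesis by (simp add: sum_distrib_right)
qed

text \<open>Replacing \<open>2\<close> to the power \<open>- 1 / f m\<close> by a rational \<open>u / D\<close> above it turns every condition
  into integer arithmetic; \<open>w / 2\<^sup>j\<close> is the lower approximation of \<open>beta\<close> read from the program.\<close>

definition certified :: "nat \<Rightarrow> nat \<Rightarrow> nat \<Rightarrow> nat \<Rightarrow> nat \<Rightarrow> nat \<Rightarrow> nat \<Rightarrow> bool" where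
  "certified j w k m l u D \<longleftrightarrow> 0 < D \<and> w * 2 ^ k \<le> 2 ^ j * psum k 1 2 \<and>
    D ^ code_num (rat_enc (f m)) < u ^ code_num (rat_enc (f m)) * 2 ^ code_den (rat_enc (f m)) \<and>
    pfst (rat_enc (h l)) mod 2 = 1 \<and>
    psum k u D * code_den (rat_enc (h l)) \<le> code_num (rat_enc (h l)) * D ^ k"

lemma f_pos: "0 < (of_rat (f m) :: real)"
  using f_ge[of m] T_pos by linarith

lemma f_quotient: "real (code_num (rat_enc (f m))) / real (code_den (rat_enc (f m))) = of_rat (f m)"
  using code_num_rat_enc[of "f m"] abs_of_pos[OF f_pos[of m]] by metis

lemma certified_iff:
  "certified j w k m l u D \<longleftrightarrow> 0 < D \<and> real w / 2 ^ j \<le> (\<Sum>y\<in>stage k. (1/2) ^ blen y) \<and>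
    2 powr (- 1 / of_rat (f m)) < real u / real D \<and> h l < 0 \<and>
    (\<Sum>y\<in>stage k. (real u / real D) ^ blen y) \<le> - of_rat (h l)"
proof (cases "0 < D")
  case True
  have "w * 2 ^ k \<le> 2 ^ j * psum k 1 2 \<longleftrightarrow> real (w * 2 ^ k) \<le> real (2 ^ j * psum k 1 2)"
    by (simp only: of_nat_le_iff)
  also have "\<dots> \<longleftrightarrow> real w * 2 ^ k \<le> (2 ^ j * (\<Sum>y\<in>stage k. (1/2) ^ blen y)) * 2 ^ k"
    using psum_eq[of 2 k 1] by (simp add: mult.assoc)
  also have "\<dots> \<longleftrightarrow> real w / 2 ^ j \<le> (\<Sum>y\<in>stage k. (1/2) ^ blen y)"
    by (simp add: field_simps)
  finally have 1: "w * 2 ^ k \<le> 2 ^ j * psum k 1 2 \<longleftrightarrow>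
    real w / 2 ^ j \<le> (\<Sum>y\<in>stage k. (1/2) ^ blen y)" .
  have "0 < code_num (rat_enc (f m))"
    using f_quotient[of m] f_pos[of m] by (cases "code_num (rat_enc (f m))") auto
  from powr_less_quotient_iff[OF True this]
  have 2: "D ^ code_num (rat_enc (f m)) < u ^ code_num (rat_enc (f m)) * 2 ^ code_den (rat_enc (f m))
      \<longleftrightarrow> 2 powr (- 1 / of_rat (f m)) < real u / real D"
    unfolding f_quotient[of m, symmetric] by simp
  have 3: "pfst (rat_enc (h l)) mod 2 = 1 \<longleftrightarrow> h l < 0"
    using odd_rat_enc_iff by (simp add: odd_iff_mod_2_eq_one)
  \<comment> \<open>As \<open>code_num\<close> is an absolute value, it represents
    \<open>- h l\<close> only for negative \<open>h l\<close>; the parity condition guarantees that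
    sign.\<close>
  have 4: "psum k u D * code_den (rat_enc (h l)) \<le> code_num (rat_enc (h l)) * D ^ k \<longleftrightarrow>
      (\<Sum>y\<in>stage k. (real u / real D) ^ blen y) \<le> - of_rat (h l)" if "h l < 0"
  proof -
    let ?d = "code_den (rat_enc (h l))" and ?n = "code_num (rat_enc (h l))"
    have d: "0 < ?d" by (rule code_den_rat_enc_pos)
    have n: "- of_rat (h l) = real ?n / real ?d"
      using code_num_rat_enc[of "h l"] that by (simp add: of_rat_minus)
    have "psum k u D * ?d \<le> ?n * D ^ k \<longleftrightarrow> real (psum k u D * ?d) \<le> real (?n * D ^ k)"
      by (simp only: of_nat_le_iff)
    also have "\<dots> \<longleftrightarrow> ((\<Sum>y\<in>stage k. (real u / real D) ^ blen y) * real ?d) * real D ^ k \<le> real ?n * real D ^ k"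
      by (simp add: psum_eq[OF True] mult_ac)
    also have "\<dots> \<longleftrightarrow> (\<Sum>y\<in>stage k. (real u / real D) ^ blen y) * real ?d \<le> real ?n"
      using True by (simp add: mult_le_cancel_right)
    also have "\<dots> \<longleftrightarrow> (\<Sum>y\<in>stage k. (real u / real D) ^ blen y) \<le> - of_rat (h l)"
      unfolding n using d by (simp add: pos_le_divide_eq)
    finally show ?thesis .
  qed
  show ?thesis unfolding certified_def 1 2 3 using True 4 by auto
qed (simp add: certified_def)

text \<open>All roundings go the safe way: u/D lies above the true base 2^(-1/f m), and
  \<open>- h l\<close> lies below \<open>theta\<close>.\<close>

lemma certified_sound:
  assumes "certified j w k m l u D"
  shows "(\<Sum>y\<in>stage k. 2 powr (- real (blen y) / of_rat (f m))) \<le> theta"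
proof -
  let ?z = "2 powr (- 1 / of_rat (f m) :: real)"
  have "(\<Sum>y\<in>stage k. 2 powr (- real (blen y) / of_rat (f m))) = (\<Sum>y\<in>stage k. ?z ^ blen y)"
    by (simp add: powr_power)
  also have "\<dots> \<le> (\<Sum>y\<in>stage k. (real u / real D) ^ blen y)"
    using assms unfolding certified_iff by (intro sum_mono power_mono) auto
  also have "\<dots> \<le> - of_rat (h l)" using assms unfolding certified_iff by blast
  also have "\<dots> \<le> theta" using h_ge[of l] by (simp add: theta_def)
  finally show ?thesis .
qed

text \<open>Some element of the infinite set \<open>A\<close> is missing from the finite stage. The
  strict inequality leaves the room in which rational approximations can be found.\<close>

lemma sum_stage_less_theta: "(\<Sum>y\<in>stage k. 2 powr (- real (blen y) / T)) < theta"
proof -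
  obtain y0 where y0: "y0 \<in> A" "y0 \<notin> stage k"
    using infinite_A finite_stage[of k] by (meson finite_subset subsetI)
  have "(\<Sum>y\<in>stage k. 2 powr (- real (blen y) / T)) <
      (\<Sum>y\<in>insert y0 (stage k). 2 powr (- real (blen y) / T))"
    using y0 finite_stage by simp
  also have "\<dots> \<le> theta"
    unfolding theta_def using y0 finite_stage stage_subset
    by (intro finite_sum_le_infsum[OF summable_A]) auto
  finally show ?thesis .
qed

text \<open>A stage that already accounts for w / 2^j of \<open>beta\<close> is fixed first. The
  strict gap at \<open>T\<close> then absorbs the errors of u/D, \<open>f m\<close> and
  \<open>h l\<close>.\<close>

lemma certified_exists:
  assumes "real w / 2 ^ j < beta"
  shows "\<exists>k m l u D. certified j w k m l u D"
proof -
  have "\<exists>F. finite F \<and> F \<subseteq> A \<and> real w / 2 ^ j < (\<Sum>y\<in>F. (1/2) ^ blen y)"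
  proof (rule ccontr)
    assume "\<not> ?thesis"
    then have "beta \<le> real w / 2 ^ j"
      unfolding beta_def by (intro infsum_le_finite_sums[OF summable_half_powers]) (auto simp: not_less)
    with assms show False by simp
  qed
  then obtain F where F: "finite F" "F \<subseteq> A" "real w / 2 ^ j < (\<Sum>y\<in>F. (1/2) ^ blen y)" by blast
  obtain k where k: "F \<subseteq> stage k" using finite_subset_stage F by blast
  have wk: "real w / 2 ^ j \<le> (\<Sum>y\<in>stage k. (1/2) ^ blen y)"
    using F(3) sum_mono2[OF finite_stage k, of "\<lambda>y. (1/2::real) ^ blen y"] by simp
  define z where "z = 2 powr (- 1 / T)"
  define p where "p = (\<lambda>q::real. \<Sum>y\<in>stage k. q ^ blen y)"
  have "p z < theta"
    using sum_stage_less_theta[of k] by (simp add: p_def z_def powr_power)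
  moreover have "0 \<le> p z" by (simp add: p_def z_def sum_nonneg)
  \<comment> \<open>The gap is divided at \<open>c\<close>: continuity of \<open>p\<close> keeps the
    stage sum below \<open>c\<close>, and convergence of \<open>h\<close> brings
    \<open>- h l\<close> above it.\<close>
  ultimately obtain c where c: "p z < c" "c < theta" "0 < c"
    using dense[of "p z" theta] by force
  have "p \<midarrow>z\<rightarrow> p z" unfolding p_def by (intro tendsto_intros)
  then have "\<forall>\<^sub>F q in at z. p q < c" using c(1) by (rule order_tendstoD)
  then obtain \<delta> where \<delta>: "0 < \<delta>" "\<And>q. q \<noteq> z \<Longrightarrow> dist q z < \<delta> \<Longrightarrow> p q < c"
    unfolding eventually_at by auto
  obtain q where q: "z < of_rat q" "of_rat q < z + \<delta>" using of_rat_dense[of z "z + \<delta>"] \<delta>(1) by auto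
  define u D where "u = code_num (rat_enc q)" and "D = code_den (rat_enc q)"
  have D: "0 < D" unfolding D_def by (rule code_den_rat_enc_pos)
  have "0 < z" by (simp add: z_def)
  with q(1) have "\<bar>of_rat q :: real\<bar> = of_rat q" by linarith
  then have uD: "real u / real D = of_rat q"
    using code_num_rat_enc[of q] unfolding u_def D_def by metis
  have pq: "p (of_rat q) < c" using q by (intro \<delta>) (auto simp: dist_real_def)
  have "(\<lambda>m. 2 powr (- 1 / of_rat (f m))) \<longlonglongrightarrow> z"
    unfolding z_def using T_pos by (intro tendsto_intros f_lim) auto
  then have "\<forall>\<^sub>F m in sequentially. 2 powr (- 1 / of_rat (f m)) < (of_rat q :: real)"
    using q(1) by (rule order_tendstoD)
  then obtain m where m: "2 powr (- 1 / of_rat (f m)) < (of_rat q :: real)"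
    using eventually_happens'[OF sequentially_bot] by blast
  have "\<forall>\<^sub>F l in sequentially. of_rat (h l) < - c"
    using order_tendstoD(2)[OF h_lim, of "- c"] c(2) by (simp add: theta_def)
  then obtain l where l: "of_rat (h l) < - c"
    using eventually_happens'[OF sequentially_bot] by blast
  have "(of_rat (h l) :: real) < 0" using l c(3) by linarith
  then have "h l < 0" by simp
  moreover have "p (of_rat q) \<le> - of_rat (h l)" using pq l by linarith
  ultimately have "certified j w k m l u D"
    unfolding certified_iff uD using D wk m by (simp add: p_def)
  then show ?thesis by blast
qed

lemma certified_close:
  obtains K N :: nat where
    "\<And>n j w k m l u D. \<lbrakk>N \<le> n; T * real n \<le> real j; beta \<le> (real w + 1) / 2 ^ j;
      certified j w k m l u D\<rbrakk> \<Longrightarrow> of_rat (f m) - T \<le> real K * (1/2) ^ n"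
proof -
  \<comment> \<open>The rate of growth is read off one fixed string. It must be nonempty, since the
    term of the empty string does not vary with the temperature.\<close>
  obtain y0 where y0: "y0 \<in> A" "0 < blen y0"
  proof -
    have "\<exists>y\<in>A. y \<noteq> 0" using infinite_A by (metis finite.simps finite_subset insertCI subsetI)
    then obtain y where "y \<in> A" "y \<noteq> 0" by blast
    moreover from this have "1 \<le> blen y" unfolding le_blen_iff by simp
    ultimately show ?thesis using that[of y] by simp
  qed
  obtain K N where KN: "\<And>n t. N \<le> n \<Longrightarrow> T \<le> t \<Longrightarrow>
      2 powr (- real (blen y0) / t) - 2 powr (- real (blen y0) / T) \<le> (1/2) ^ n
      \<Longrightarrow> t - T \<le> real K * (1/2) ^ n"
    using exponential_gap_bound[OF T_pos y0(2)] by metis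
  obtain N' :: nat where N': "real (blen y0) / T < real N'" using reals_Archimedean2 by blast
  show ?thesis
  proof
    fix n j w k m l u D
    assume n: "max N N' \<le> n" and j: "T * real n \<le> real j" and w: "beta \<le> (real w + 1) / 2 ^ j"
      and cert: "certified j w k m l u D"
    let ?t = "of_rat (f m) :: real"
    let ?x = "\<lambda>y. (1/2::real) ^ blen y"
    have t: "T \<le> ?t" by (rule f_ge)
    have "real w / 2 ^ j \<le> sum ?x (stage k)" using cert unfolding certified_iff by blast
    then have tail: "beta \<le> sum ?x (stage k) + (1/2) ^ j"
      using w by (simp add: add_divide_distrib power_one_over)
    \<comment> \<open>If \<open>y0\<close> were missing, its weight would be at most 2^(-j), but the
      choice of \<open>N'\<close> makes \<open>j\<close> larger than its length.\<close>
    have y0_stage: "y0 \<in> stage k"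
    proof (rule ccontr)
      assume "y0 \<notin> stage k"
      then have "sum ?x (stage k) + ?x y0 = sum ?x (insert y0 (stage k))"
        using finite_stage by simp
      also have "\<dots> \<le> beta"
        unfolding beta_def using y0 finite_stage stage_subset
        by (intro finite_sum_le_infsum[OF summable_half_powers]) auto
      finally have "(1/2::real) ^ blen y0 \<le> (1/2) ^ j" using tail by linarith
      then have "j \<le> blen y0"
        using power_strict_decreasing[of "blen y0" j "1/2::real"] by (cases "blen y0 < j") auto
      moreover have "real (blen y0) < real j"
      proof -
        have "real (blen y0) < T * real N'" using N' T_pos by (simp add: field_simps)
        also have "\<dots> \<le> T * real n" using n T_pos by simp
        finally show ?thesis using j by simp
      qed
      ultimately show False by simp
    qed
    have powr: "?x y powr (1 / T) = 2 powr (- real (blen y) / T)" for y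
    proof -
      have "?x y = 2 powr (- real (blen y))"
        by (simp add: powr_minus_divide powr_realpow power_one_over)
      then show ?thesis by (simp add: powr_powr)
    qed
    have "theta \<le> (\<Sum>y\<in>stage k. 2 powr (- real (blen y) / T)) + ((1/2) ^ j) powr (1 / T)"
      using infsum_powr_le_finite_sum[of ?x A "1 / T" "stage k" "(1/2) ^ j"]
        summable_half_powers summable_A finite_stage stage_subset tail T_pos T_less_1
      by (simp add: powr theta_def beta_def)
    also have "((1/2::real) ^ j) powr (1 / T) \<le> (1/2) ^ n"
    proof -
      have "((1/2::real) ^ j) powr (1 / T) = 2 powr (- (real j / T))"
        by (simp add: power_one_over powr_realpow[symmetric] powr_minus_divide[symmetric] powr_powr)
      also have "\<dots> \<le> 2 powr (- real n)"
        using j T_pos by (simp add: field_simps)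
      also have "\<dots> = (1/2) ^ n" by (simp add: powr_minus_divide powr_realpow power_one_over)
      finally show ?thesis .
    qed
    finally have "theta \<le> (\<Sum>y\<in>stage k. 2 powr (- real (blen y) / T)) + (1/2) ^ n" by simp
    with certified_sound[OF cert]
    have gap: "(\<Sum>y\<in>stage k. 2 powr (- real (blen y) / ?t) - 2 powr (- real (blen y) / T)) \<le> (1/2) ^ n"
      by (simp add: sum_subtractf)
    \<comment> \<open>Because ?t \<ge> T, no term decreases, so the term of \<open>y0\<close> alone
      obeys the bound on the total gap.\<close>
    have "2 powr (- real (blen y0) / ?t) - 2 powr (- real (blen y0) / T) \<le>
        (\<Sum>y\<in>stage k. 2 powr (- real (blen y) / ?t) - 2 powr (- real (blen y) / T))"
    proof (rule member_le_sum[OF y0_stage _ finite_stage])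
      fix y
      have "real (blen y) / ?t \<le> real (blen y) / T" 
        using t mult_pos_pos[OF f_pos T_pos] by (intro divide_left_mono) auto
      then show "0 \<le> 2 powr (- real (blen y) / ?t) - 2 powr (- real (blen y) / T)" by simp
    qed
    with gap show "?t - T \<le> real K * (1/2) ^ n" using n t by (intro KN) auto
  qed
qed

end

section \<open>The decoding machine\<close>

text \<open>This is the string code of the lowest \<open>n\<close> binary digits of
  \<open>M\<close>, most significant first. In bijective base two the bits 0 and 1 count as 1 and
  2.\<close>

definition bitcode :: "nat \<Rightarrow> nat \<Rightarrow> nat" where
  "bitcode n M = (\<Sum>i<n. 2 ^ i * (1 + M div 2 ^ (n - 1 - i) mod 2))"

lemma enc_bl_map_upt: "enc_bl (map g [0..<n]) = (\<Sum>i<n. 2 ^ i * (1 + of_bool (g i)))"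
  by (induction n) (auto simp: enc_bl_append)

lemma dec_bl_bitcode:
  assumes "0 \<le> \<alpha>" "\<alpha> < 1"
  shows "dec_bl (bitcode n (nat \<lfloor>2 ^ n * \<alpha>\<rfloor>)) = bits \<alpha> n"
proof -
  have "frac \<alpha> = \<alpha>" using assms by (simp add: frac_eq)
  moreover have "[1..<Suc n] = map Suc [0..<n]" by (simp only: map_Suc_upt One_nat_def)
  ultimately have "enc_bl (bits \<alpha> n) = enc_bl (map (\<lambda>i. odd \<lfloor>2 ^ Suc i * \<alpha>\<rfloor>) [0..<n])"
    by (simp only: bits_def map_map comp_def)
  also have "\<dots> = (\<Sum>i<n. 2 ^ i * (1 + of_bool (odd \<lfloor>2 ^ Suc i * \<alpha>\<rfloor>)))"
    by (rule enc_bl_map_upt)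
  also have "\<dots> = bitcode n (nat \<lfloor>2 ^ n * \<alpha>\<rfloor>)"
    unfolding bitcode_def
  proof (rule sum.cong[OF refl])
    fix i assume i: "i \<in> {..<n}"
    define M where "M = nat \<lfloor>2 ^ n * \<alpha>\<rfloor>"
    have M: "int M = \<lfloor>2 ^ n * \<alpha>\<rfloor>" using assms by (simp add: M_def)
    \<comment> \<open>Rounding down to a multiple of 2^(-n) first does not affect the earlier bits:
      they arise from the integer \<open>M\<close> by division.\<close>
    have "2 ^ Suc i * \<alpha> = 2 ^ n * \<alpha> / real_of_int (2 ^ (n - 1 - i))"
    proof -
      have "(2::real) ^ n = 2 ^ Suc i * 2 ^ (n - 1 - i)"
        using i unfolding power_add[symmetric] by simp
      then show ?thesis by simp
    qed
    then have "\<lfloor>2 ^ Suc i * \<alpha>\<rfloor> = int M div 2 ^ (n - 1 - i)"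
      using floor_divide_real_eq_div[of "2 ^ (n - 1 - i)" "2 ^ n * \<alpha>"] by (simp add: M)
    also have "\<dots> = int (M div 2 ^ (n - 1 - i))" by (simp add: zdiv_int)
    finally have "odd \<lfloor>2 ^ Suc i * \<alpha>\<rfloor> \<longleftrightarrow> odd (M div 2 ^ (n - 1 - i))" by simp
    then show "2 ^ i * (1 + of_bool (odd \<lfloor>2 ^ Suc i * \<alpha>\<rfloor>)) = 2 ^ i * (1 + M div 2 ^ (n - 1 - i) mod 2)"
      by (simp add: mod_2_eq_odd)
  qed
  finally show ?thesis by (metis dec_bl_enc_bl)
qed

lemma computable_bitcode:
  assumes "computable f" "computable g"
  shows "computable (\<lambda>x. bitcode (f x) (g x))"
  unfolding bitcode_def
  by (intro computable_sum computable_mult computable_power computable_add computable_mod computable_div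
      computable_diff computable_const computable_pfst computable_psnd computable_id assms
      computable_compose[OF assms(1)] computable_compose[OF assms(2)])

text \<open>The unary length makes \<open>b\<close> self-delimiting at a cost of 2|b| + 1 bits.
  Nothing delimits \<open>v\<close>; its length has to be prescribed by \<open>b\<close>.\<close>

definition program :: "bool list \<Rightarrow> bool list \<Rightarrow> bool list" where
  "program b v = replicate (length b) True @ False # b @ v"

lemma program_append_eqD:
  assumes "program b v = program b' v' @ r"
  shows "b = b' \<and> v = v' @ r"
proof -
  have "length b = length b' \<and> b @ v = b' @ v' @ r"
    using assms unfolding program_def by (intro replicate_True_False_eqD) simp
  then show ?thesis by auto
qed

lemma enc_bl_program:
  "enc_bl (program b v) + 2 =
    2 * 2 ^ length b + 2 ^ length b * (1 + 2 * (enc_bl b + 2 ^ length b * enc_bl v))"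
  using enc_bl_replicate_True[of "length b"] by (simp add: program_def enc_bl_append)

context temperature
begin

text \<open>A certificate is packed into a single number so that there is a least one.\<close>

definition cert :: "nat \<Rightarrow> nat \<Rightarrow> nat \<Rightarrow> bool" where
  "cert j w \<tau> \<longleftrightarrow> certified j w (pfst \<tau>) (pfst (psnd \<tau>)) (pfst (psnd (psnd \<tau>)))
    (pfst (psnd (psnd (psnd \<tau>)))) (psnd (psnd (psnd (psnd \<tau>))))"

lemma computable_rat_enc_f: "computable g \<Longrightarrow> computable (\<lambda>x. rat_enc (f (g x)))"
  using f_recursive unfolding total_recursive_rat_seq_def computable_iff_partial_recursive[symmetric]
  by (rule computable_compose)

lemma computable_rat_enc_h: "computable g \<Longrightarrow> computable (\<lambda>x. rat_enc (h (g x)))"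
  using h_recursive unfolding total_recursive_rat_seq_def computable_iff_partial_recursive[symmetric]
  by (rule computable_compose)

lemma computable_psum:
  assumes "computable k" "computable u" "computable D"
  shows "computable (\<lambda>x. psum (k x) (u x) (D x))"
  unfolding psum_def
  by (intro computable_sum computable_if decidable_compose2[OF E_decidable] computable_mult
      computable_power computable_blen computable_diff computable_const computable_pfst computable_psnd
      computable_id assms computable_compose[OF assms(1)] computable_compose[OF assms(2)]
      computable_compose[OF assms(3)])

lemma decidable_cert:
  assumes "computable j" "computable w" "computable \<tau>"
  shows "decidable (\<lambda>x. cert (j x) (w x) (\<tau> x))"
  unfolding cert_def certified_def
  by (intro decidable_conj decidable_less decidable_le decidable_eq computable_mult computable_power
      computable_mod computable_psum computable_code_num computable_code_den computable_rat_enc_f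
      computable_rat_enc_h computable_const computable_pfst computable_psnd assms)

text \<open>The program consists of a self-delimiting part \<open>b\<close>, the code of \<open>n\<close>, \<open>j\<close> and the final
  correction \<open>c\<close>, and of \<open>j\<close> further bits coding \<open>w\<close>. Demanding the least certificate, which depends only
  on \<open>j\<close> and \<open>w\<close>, makes the approximation independent of \<open>c\<close>.\<close>

definition decodes :: "nat \<Rightarrow> nat \<Rightarrow> nat \<Rightarrow> nat \<Rightarrow> bool" where
  "decodes x B W \<tau> \<longleftrightarrow>
    x + 2 = 2 * 2 ^ blen B + 2 ^ blen B * (1 + 2 * (B + 2 ^ blen B * W)) \<and>
    blen W = pfst (psnd B) \<and> cert (pfst (psnd B)) (Suc W - 2 ^ pfst (psnd B)) \<tau> \<and>
    (\<forall>\<sigma><\<tau>. \<not> cert (pfst (psnd B)) (Suc W - 2 ^ pfst (psnd B)) \<sigma>)"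

text \<open>The second argument of \<open>bitcode\<close> is the floor of 2^n * t, for the
  approximation t named by the certificate, minus the correction.\<close>

definition decode_out :: "nat \<Rightarrow> nat \<Rightarrow> nat" where
  "decode_out B \<tau> = bitcode (pfst B)
    (2 ^ pfst B * code_num (rat_enc (f (pfst (psnd \<tau>)))) div code_den (rat_enc (f (pfst (psnd \<tau>))))
      - psnd (psnd B))"

definition decoder :: "bool list \<Rightarrow> bool list option" where
  "decoder p = (if \<exists>z. decodes (enc_bl p) (pfst (pfst z)) (psnd (pfst z)) (psnd z)
    then Some (dec_bl ((\<lambda>z. decode_out (pfst (pfst z)) (psnd z))
      (LEAST z. decodes (enc_bl p) (pfst (pfst z)) (psnd (pfst z)) (psnd z)))) else None)"

lemma decodes_iff:
  "decodes (enc_bl p) B W \<tau> \<longleftrightarrow> p = program (dec_bl B) (dec_bl W) \<and> blen W = pfst (psnd B) \<and>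
    cert (pfst (psnd B)) (Suc W - 2 ^ pfst (psnd B)) \<tau> \<and>
    (\<forall>\<sigma><\<tau>. \<not> cert (pfst (psnd B)) (Suc W - 2 ^ pfst (psnd B)) \<sigma>)"
proof -
  have "enc_bl p + 2 = 2 * 2 ^ blen B + 2 ^ blen B * (1 + 2 * (B + 2 ^ blen B * W)) \<longleftrightarrow>
      enc_bl p + 2 = enc_bl (program (dec_bl B) (dec_bl W)) + 2"
    unfolding enc_bl_program by (simp add: blen_def)
  also have "\<dots> \<longleftrightarrow> p = program (dec_bl B) (dec_bl W)"
    unfolding add_right_cancel by (metis dec_bl_enc_bl)
  finally show ?thesis unfolding decodes_def by simp
qed

text \<open>A program is parsed in only one way, and the least certificate is unique; hence the
  search in \<open>decoder\<close> has at most one possible outcome.\<close>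

lemma decodes_unique:
  assumes "decodes (enc_bl p) B W \<tau>" "decodes (enc_bl p) B' W' \<tau>'"
  shows "B = B' \<and> W = W' \<and> \<tau> = \<tau>'"
proof -
  have "program (dec_bl B) (dec_bl W) = program (dec_bl B') (dec_bl W') @ []"
    using assms unfolding decodes_iff by simp
  from program_append_eqD[OF this] have "dec_bl B = dec_bl B'" "dec_bl W = dec_bl W'" by auto
  then have "B = B'" "W = W'" by (metis enc_bl_dec_bl)+
  moreover from this assms have "\<tau> = \<tau>'"
    unfolding decodes_iff by (metis linorder_neqE_nat)
  ultimately show ?thesis by blast
qed

lemma decoder_eq:
  assumes "decodes (enc_bl p) B W \<tau>"
  shows "decoder p = Some (dec_bl (decode_out B \<tau>))"
proof -
  let ?P = "\<lambda>z. decodes (enc_bl p) (pfst (pfst z)) (psnd (pfst z)) (psnd z)"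
  have "z = pair (pair B W) \<tau>" if "?P z" for z
    using decodes_unique[OF that assms] by (metis pair_pfst_psnd)
  moreover have "?P (pair (pair B W) \<tau>)" using assms by simp
  ultimately have "(LEAST z. ?P z) = pair (pair B W) \<tau>"
    by (intro Least_equality) (auto intro: order_refl)
  then show ?thesis
    using exI[of ?P, OF \<open>?P (pair (pair B W) \<tau>)\<close>] unfolding decoder_def by simp
qed

lemma prefix_free_decoder: "prefix_free_machine decoder"
  unfolding prefix_free_machine_def
proof
  have "decidable (\<lambda>z. decodes (pfst z) (pfst (pfst (psnd z))) (psnd (pfst (psnd z))) (psnd (psnd z)))"
    unfolding decodes_def
    by (intro decidable_conj decidable_eq decidable_ball decidable_not decidable_cert computable_add
        computable_mult computable_power computable_blen computable_diff computable_Suc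
        computable_const computable_pfst computable_psnd computable_id)
  moreover have "computable (\<lambda>z. decode_out (pfst (pfst z)) (psnd z))"
    unfolding decode_out_def
    by (intro computable_bitcode computable_diff computable_div computable_mult computable_power
        computable_code_num computable_code_den computable_rat_enc_f computable_const
        computable_pfst computable_psnd computable_id)
  ultimately show "partial_recursive_bl decoder"
    unfolding decoder_def by (rule partial_recursive_bl_search)
  show "prefix_free_set (dom decoder)"
    unfolding prefix_free_set_def
  proof (intro ballI allI impI)
    fix p q r assume p: "p \<in> dom decoder" and q: "q \<in> dom decoder" and eq: "q = p @ r"
    have dom: "\<exists>B W. p = program (dec_bl B) (dec_bl W) \<and> blen W = pfst (psnd B)"
      if p: "p \<in> dom decoder" for p
    proof -
      obtain z where "decodes (enc_bl p) (pfst (pfst z)) (psnd (pfst z)) (psnd z)"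
        using p unfolding decoder_def by (auto split: if_splits)
      then show ?thesis unfolding decodes_iff by blast
    qed
    obtain B W B' W' where BW: "p = program (dec_bl B) (dec_bl W)" "blen W = pfst (psnd B)"
      "q = program (dec_bl B') (dec_bl W')" "blen W' = pfst (psnd B')"
      using dom[OF p] dom[OF q] by blast
    with eq have "program (dec_bl B') (dec_bl W') = program (dec_bl B) (dec_bl W) @ r" by simp
    from program_append_eqD[OF this] have *: "dec_bl B' = dec_bl B" "dec_bl W' = dec_bl W @ r"
      by auto
    then have "B' = B" by (metis enc_bl_dec_bl)
    \<comment> \<open>Equal headers prescribe the same length for both tails, so nothing can be
      appended.\<close>
    with BW *(2) show "r = []" unfolding blen_def by simp
  qed
qed

lemma beta_pos: "0 < beta"
proof -
  obtain y where "y \<in> A" using infinite_A by (metis all_not_in_conv finite.emptyI)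
  then have "(\<Sum>y\<in>{y}. (1/2::real) ^ blen y) \<le> beta"
    unfolding beta_def by (intro finite_sum_le_infsum[OF summable_half_powers]) auto
  then have "(1/2::real) ^ blen y \<le> beta" by simp
  moreover have "0 < (1/2::real) ^ blen y" by (rule zero_less_power) simp
  ultimately show ?thesis by linarith
qed

lemma short_programs:
  obtains K N :: nat where
    "\<And>n. N \<le> n \<Longrightarrow> \<exists>p j c. decoder p = Some (bits T n) \<and> c \<le> K \<and> real j \<le> T * real n + 1 \<and>
      length p = 2 * blen (pair n (pair j c)) + 1 + j"
proof -
  obtain K N where KN: "\<And>n j w k m l u D. \<lbrakk>N \<le> n; T * real n \<le> real j; beta \<le> (real w + 1) / 2 ^ j;
      certified j w k m l u D\<rbrakk> \<Longrightarrow> of_rat (f m) - T \<le> real K * (1/2) ^ n"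
    using certified_close by metis
  show ?thesis
  proof
    fix n assume n: "N \<le> n"
    define j where "j = nat \<lceil>T * real n\<rceil>"
    have "0 \<le> T * real n" using T_pos by simp
    then have j: "T * real n \<le> real j" "real j \<le> T * real n + 1"
      unfolding j_def by linarith+
    \<comment> \<open>Ceiling minus one, instead of the floor, keeps w / 2^j strictly below
      \<open>beta\<close> even when \<open>beta\<close> is dyadic; \<open>beta_pos\<close> makes it
      a natural number.\<close>
    define w where "w = nat (\<lceil>2 ^ j * beta\<rceil> - 1)"
    have "0 < 2 ^ j * beta" using beta_pos by simp
    then have w: "real w < 2 ^ j * beta" "2 ^ j * beta \<le> real w + 1"
      unfolding w_def by linarith+
    have "2 ^ j * beta \<le> 2 ^ j" using beta_le_1 by simp
    with w(1) have "real w < 2 ^ j" by linarith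
    then have "real w < real (2 ^ j)" by (simp only: of_nat_power of_nat_numeral)
    then have w_less: "w < 2 ^ j" by (simp only: of_nat_less_iff)
    have "real w / 2 ^ j < beta" using w(1) by (simp add: field_simps)
    then obtain k m l u D where "certified j w k m l u D" using certified_exists by blast
    then have ex: "cert j w (pair k (pair m (pair l (pair u D))))" by (simp add: cert_def)
    define \<tau> where "\<tau> = (LEAST \<tau>. cert j w \<tau>)"
    have cert: "cert j w \<tau>" unfolding \<tau>_def using ex by (rule LeastI)
    \<comment> \<open>Codes of strings of length \<open>j\<close> start at 2^j - 1, so
      \<open>W\<close> codes the string with index \<open>w\<close> among them, counted from
      0.\<close>
    define W where "W = w + 2 ^ j - 1"
    have W: "Suc W - 2 ^ j = w" by (simp add: W_def)
    have "i \<le> blen W \<longleftrightarrow> i \<le> j" for i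
    proof -
      have "Suc W = w + 2 ^ j" by (simp add: W_def)
      moreover have "2 ^ i \<le> w + 2 ^ j \<longleftrightarrow> i \<le> j"
      proof
        assume "2 ^ i \<le> w + 2 ^ j"
        also have "w + 2 ^ j < 2 ^ Suc j" using w_less by simp
        finally have "i < Suc j" by (rule power_less_imp_less_exp[rotated]) simp
        then show "i \<le> j" by simp
      next
        assume "i \<le> j"
        then have "(2::nat) ^ i \<le> 2 ^ j" by simp
        then show "2 ^ i \<le> w + 2 ^ j" by linarith
      qed
      ultimately show ?thesis unfolding le_blen_iff by simp
    qed
    then have blen_W: "blen W = j" by (metis order_antisym order_refl)
    define t where "t = pfst (psnd \<tau>)"
    have ft: "T \<le> of_rat (f t)" by (rule f_ge)
    have "of_rat (f t) - T \<le> real K * (1/2) ^ n"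
    proof (rule KN[OF n j(1)])
      show "beta \<le> (real w + 1) / 2 ^ j" using w(2) by (simp add: field_simps)
      show "certified j w (pfst \<tau>) t (pfst (psnd (psnd \<tau>))) (pfst (psnd (psnd (psnd \<tau>))))
          (psnd (psnd (psnd (psnd \<tau>))))"
        using cert by (simp add: cert_def t_def)
    qed
    then have "2 ^ n * of_rat (f t) \<le> 2 ^ n * T + real K"
      by (simp add: power_one_over field_simps)
    define M where "M = 2 ^ n * code_num (rat_enc (f t)) div code_den (rat_enc (f t))"
    have M: "int M = \<lfloor>2 ^ n * (of_rat (f t) :: real)\<rfloor>"
    proof -
      have "\<lfloor>real (2 ^ n * code_num (rat_enc (f t))) / real (code_den (rat_enc (f t)))\<rfloor> = int M"
        unfolding M_def by (rule floor_divide_of_nat_eq)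
      moreover have "real (2 ^ n * code_num (rat_enc (f t))) / real (code_den (rat_enc (f t))) =
          2 ^ n * of_rat (f t)"
        unfolding f_quotient[symmetric] by simp
      ultimately show ?thesis by simp
    qed
    \<comment> \<open>The approximation exceeds \<open>T\<close> by at most K * 2^(-n), so the two
      floors differ by at most \<open>K\<close>.\<close>
    define c where "c = M - nat \<lfloor>2 ^ n * T\<rfloor>"
    have "0 \<le> 2 ^ n * T" using T_pos by simp
    moreover have "2 ^ n * T \<le> 2 ^ n * of_rat (f t)" using ft by simp
    then have "\<lfloor>2 ^ n * T\<rfloor> \<le> int M" unfolding M by (rule floor_mono)
    moreover have "int M \<le> \<lfloor>2 ^ n * T\<rfloor> + int K"
      unfolding M using \<open>2 ^ n * of_rat (f t) \<le> 2 ^ n * T + real K\<close> by linarith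
    ultimately have c: "M - c = nat \<lfloor>2 ^ n * T\<rfloor>" "c \<le> K"
      unfolding c_def by linarith+
    define B where "B = pair n (pair j c)"
    have B: "pfst B = n" "pfst (psnd B) = j" "psnd (psnd B) = c" by (simp_all add: B_def)
    let ?p = "program (dec_bl B) (dec_bl W)"
    have "\<forall>\<sigma><\<tau>. \<not> cert j w \<sigma>" unfolding \<tau>_def using not_less_Least by blast
    then have "decodes (enc_bl ?p) B W \<tau>"
      unfolding decodes_iff B W using blen_W cert by simp
    then have "decoder ?p = Some (dec_bl (decode_out B \<tau>))" by (rule decoder_eq)
    also have "decode_out B \<tau> = bitcode n (nat \<lfloor>2 ^ n * T\<rfloor>)"
      unfolding decode_out_def B t_def[symmetric] M_def[symmetric] c(1) ..
    also have "dec_bl \<dots> = bits T n" using T_pos T_less_1 by (intro dec_bl_bitcode) auto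
    finally have "decoder ?p = Some (bits T n)" .
    moreover have "length ?p = 2 * blen B + 1 + j"
      using blen_W by (simp add: program_def blen_def)
    ultimately show "\<exists>p j c. decoder p = Some (bits T n) \<and> c \<le> K \<and> real j \<le> T * real n + 1 \<and>
        length p = 2 * blen (pair n (pair j c)) + 1 + j"
      using c(2) j(2) unfolding B_def by blast
  qed
qed

end

section \<open>The fixed point theorem\<close>

text \<open>A polynomial bound on codes keeps the header of the program logarithmic in
  \<open>n\<close>.\<close>

lemma pair_le: "pair a b \<le> (a + b + 1)\<^sup>2"
proof -
  have "triangle s \<le> s * Suc s" for s unfolding triangle_def by simp
  from this[of "a + b"] show ?thesis
    by (simp add: pair_def prod_encode_def power2_eq_square algebra_simps)
qed

lemma blen_le_log: "real (blen y) \<le> log 2 (real y + 1)"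
proof -
  have "2 ^ blen y \<le> Suc y" using le_blen_iff[of "blen y" y] by simp
  then have "real (2 ^ blen y) \<le> real (Suc y)" by (simp only: of_nat_le_iff)
  then show ?thesis by (simp add: le_log_iff powr_realpow add.commute)
qed

theorem theorem12:
  fixes U V :: "bool list \<Rightarrow> bool list option" and T :: real
  assumes "optimal_machine U"
    and "optimal_machine V"
    and "0 < T" and "T < 1"
    and "(\<lambda>s. 2 powr (- real (length s) / T)) summable_on Theta_set V"
    and "left_computable (Theta V T)"
    and "right_computable T"
  shows "T_compressible U T T"
proof -
  obtain f where f: "total_recursive_rat_seq f" "\<And>m. T \<le> of_rat (f m)" "(\<lambda>m. of_rat (f m)) \<longlonglongrightarrow> T"
    using assms(7) unfolding right_computable_def by blast
  obtain h where h: "total_recursive_rat_seq h" "\<And>l. - Theta V T \<le> of_rat (h l)"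
    "(\<lambda>l. of_rat (h l)) \<longlonglongrightarrow> - Theta V T"
    using assms(6) unfolding left_computable_def right_computable_def by blast
  have V: "partial_recursive_bl V" "prefix_free_set (dom V)"
    using assms(2) unfolding optimal_machine_def prefix_free_machine_def by auto
  obtain E where E: "decidable (\<lambda>z. E (pfst z) (psnd z))" "\<forall>k y. E k y \<longrightarrow> y < k"
    "\<forall>k k' y. E k y \<longrightarrow> k \<le> k' \<longrightarrow> E k' y" "\<forall>y. dec_bl y \<in> Theta_set V \<longleftrightarrow> (\<exists>k. E k y)"
    using Theta_set_enumerable[OF V(1)] by (elim exE conjE)
  define A where "A = enc_bl ` Theta_set V"
  have A: "y \<in> A \<longleftrightarrow> dec_bl y \<in> Theta_set V" for y
    unfolding A_def by (metis (no_types) dec_bl_enc_bl enc_bl_dec_bl image_iff)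
  have Theta: "(\<Sum>\<^sub>\<infinity>y\<in>A. 2 powr (- real (blen y) / T)) = Theta V T"
    unfolding A_def Theta_def by (subst infsum_reindex[OF inj_enc_bl]) (simp add: comp_def)
  interpret temperature T E f h A
  proof
    show "(\<Sum>y\<in>F. (1/2::real) ^ blen y) \<le> 1" if "finite F" "F \<subseteq> A" for F
    proof -
      have "inj_on dec_bl F" by (rule inj_on_inverseI[of _ enc_bl]) simp
      then have "(\<Sum>y\<in>F. (1/2::real) ^ blen y) = (\<Sum>s\<in>dec_bl ` F. (1/2) ^ length s)"
        by (simp add: sum.reindex blen_def)
      also have "\<dots> \<le> 1" using that A by (intro sum_Theta_set_le_1[OF V(2)]) auto
      finally show ?thesis .
    qed
    show "infinite A"
      unfolding A_def using infinite_Theta_set[OF assms(2)] finite_imageD[OF _ inj_enc_bl] by blast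
    show "(\<lambda>y. 2 powr (- real (blen y) / T)) summable_on A"
      unfolding A_def using assms(5) by (subst summable_on_reindex[OF inj_enc_bl]) (simp add: comp_def)
  qed (use assms E f h A Theta in auto)
  obtain K N where KN: "\<And>n. N \<le> n \<Longrightarrow> \<exists>p j c. decoder p = Some (bits T n) \<and> c \<le> K \<and>
      real j \<le> T * real n + 1 \<and> length p = 2 * blen (pair n (pair j c)) + 1 + j"
    using short_programs by metis
  obtain d where d: "\<And>p. p \<in> dom decoder \<Longrightarrow> \<exists>q\<in>dom U. U q = decoder p \<and> length q \<le> length p + d"
    using assms(1) prefix_free_decoder unfolding optimal_machine_def by blast
  \<comment> \<open>The 2 accounts for the separating bit and for rounding \<open>j\<close> up,
    \<open>d\<close> for the change of machine, and the logarithm for the header, whose payload is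
    counted twice.\<close>
  define g where "g = (\<lambda>n::nat. (T * real n + 2 + real d +
    2 * log 2 ((real n + (real n + real K + 2)\<^sup>2 + 1)\<^sup>2 + 1)) / real n)"
  have bound: "ereal_of_enat (HC U (bits T n)) / ereal (real n) \<le> ereal (g n)" if n: "max N 1 \<le> n" for n
  proof -
    obtain p j c where p: "decoder p = Some (bits T n)" "c \<le> K" "real j \<le> T * real n + 1"
      "length p = 2 * blen (pair n (pair j c)) + 1 + j"
      using KN[of n] n by auto
    obtain q where q: "U q = Some (bits T n)" "length q \<le> length p + d"
      using d[of p] p(1) by auto
    have "T * real n \<le> real n" using assms(4) mult_right_mono[of T 1 "real n"] by simp
    then have "j \<le> n + 1" using p(3) by linarith
    then have "pair j c \<le> (n + K + 2)\<^sup>2"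
      using pair_le[of j c] p(2) power_mono[of "j + c + 1" "n + K + 2" 2] by linarith
    then have "pair n (pair j c) \<le> (n + (n + K + 2)\<^sup>2 + 1)\<^sup>2"
      using pair_le[of n "pair j c"] power_mono[of "n + pair j c + 1" "n + (n + K + 2)\<^sup>2 + 1" 2]
      by linarith
    then have "real (pair n (pair j c)) \<le> real ((n + (n + K + 2)\<^sup>2 + 1)\<^sup>2)"
      by (simp only: of_nat_le_iff)
    then have "real (pair n (pair j c)) + 1 \<le> (real n + (real n + real K + 2)\<^sup>2 + 1)\<^sup>2 + 1" by (simp add: ac_simps)
    then have "real (blen (pair n (pair j c))) \<le> log 2 ((real n + (real n + real K + 2)\<^sup>2 + 1)\<^sup>2 + 1)"
      by (intro order_trans[OF blen_le_log] log_mono) auto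
    then have "real (length q) / real n \<le> g n"
      unfolding g_def using q(2) p(3,4) n by (intro divide_right_mono) auto
    moreover have "HC U (bits T n) \<le> enat (length q)"
      unfolding HC_def using q(1) by (intro INF_lower) auto
    then have "ereal_of_enat (HC U (bits T n)) \<le> ereal (real (length q))"
      by (metis ereal_of_enat_le_iff ereal_of_enat_simps(1))
    then have "ereal_of_enat (HC U (bits T n)) / ereal (real n) \<le> ereal (real (length q)) / ereal (real n)"
      using n by (intro ereal_divide_right_mono) auto
    ultimately show ?thesis using n by (auto intro: order_trans)
  qed
  have "g \<longlonglongrightarrow> T" unfolding g_def by real_asymp
  then have "limsup (\<lambda>n. ereal (g n)) = ereal T"
    by (intro lim_imp_Limsup) auto
  moreover have "limsup (\<lambda>n. ereal_of_enat (HC U (bits T n)) / ereal (real n)) \<le> limsup (\<lambda>n. ereal (g n))"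
    by (intro Limsup_mono eventually_sequentiallyI[of "max N 1"] bound)
  ultimately show ?thesis unfolding T_compressible_def by simp
qed

end
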